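(* Let $T_{1234}$ be a generalized hyperbolic tetrahedron determined by points $v_1,v_2,v_3,v_4\in\mathbb{H}^3\cup C^+\cup S^+$ (of any of the 15 types), with edge lengths $x_{ij}$ and dihedral angles $a_{ij}$ at the edges $e_{ij}$, where $a_{ij}=a_{ji}$, $x_{ij}=x_{ji}$. For fixed types of the points $v_i$, regard each dihedral angle $a_{ij}$ as a function of the six edge lengths $x_{12},x_{13},x_{14},x_{23},x_{24},x_{34}$. Let $G=(\langle v_i,v_j\rangle)_{4\times 4}$ be the Gram matrix and let $G_{ii}$ be the matrix obtained from $G$ by deleting the $i$-th row and $i$-th column. Then the Jacobian matrix is $$\frac{\partial(a_{12},a_{13},a_{14},a_{23},a_{24},a_{34})}{\partial(x_{12},x_{13},x_{14},x_{23},x_{24},x_{34})}= \sqrt{\frac{\det G_{11}\det G_{22}\det G_{33}\det G_{44}}{-(\det G)^3}}\;DMD,$$ where $$D=\mathrm{diag}(\sin a_{12},\sin a_{13},\sin a_{14},\sin a_{23},\sin a_{24},\sin a_{34})$$ and $$ M=\left( \begin{matrix} w_{12} & -\cos a_{23} & -\cos a_{24} & -\cos a_{13} & -\cos a_{14} & 1 \\ -\cos a_{23} & w_{13} & -\cos a_{34} & -\cos a_{12} & 1 & -\cos a_{14} \\ -\cos a_{24} & -\cos a_{34} & w_{14} & 1 & -\cos a_{12} & -\cos a_{13} \\ -\cos a_{13} & -\cos a_{12} & 1 & w_{23} & -\cos a_{34} & -\cos a_{24} \\ -\cos a_{14} & 1 & -\cos a_{12} & -\cos a_{34} & w_{24}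 & -\cos a_{23} \\ 1 & -\cos a_{14} & -\cos a_{13} & -\cos a_{24} & -\cos a_{23} & w_{34} \end{matrix} \right), $$ with, for $\{i,j,k,l\}=\{1,2,3,4\}$, $$w_{ij}=\frac{\cos a_{ij}\cos a_{jk}\cos a_{ki} +\cos a_{ij}\cos a_{jl}\cos a_{li} +\cos a_{ik}\cos a_{jl} +\cos a_{il}\cos a_{jk}}{\sin^2a_{ij}}.$$
   Context: Minkowski space is $\mathbb{R}^4$ with $\langle X,Y\rangle=x_1y_1+x_2y_2+x_3y_3-x_4y_4$. Put $\mathbb{H}^3=\{X:\langle X,X\rangle=-1,\ x_4>0\}$ (hyperbolic space), $C^+=\{X:\langle X,X\rangle=0,\ x_4>0\}$, $S^+=\{X:\langle X,X\rangle=1,\ x_4>0\}$. The type of $v_i\in\mathbb{H}^3\cup C^+\cup S^+$ is $\varepsilon_i=-\langle v_i,v_i\rangle\in\{1,0,-1\}$. To $v_i$ one associates a subset $P_{\varepsilon_i}(v_i)$ of $\mathbb{H}^3$: if $v_i\in\mathbb{H}^3$, $P_1(v_i)=v_i$ (the point itself); if $v_i\in C^+$, $P_0(v_i)=\{X\in\mathbb{H}^3:\langle X,v_i\rangle\ge -\frac12\}$ (a horoball); if $v_i\in S^+$, $P_{-1}(v_i)=\{X\in\mathbb{H}^3:\langle X,v_i\rangle\ge 0\}$ (a half space). Let $v_1,\dots,v_4\in\mathbb{H}^3\cup C^+\cup S^+$ be such that $P_{\varepsilon_1}(v_1),\dots,P_{\varepsilon_4}(v_4)$ are pairwise disjoint.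 The edge $e_{ij}$ is the geodesic segment in $\mathbb{H}^3$ whose length realizes the distance between $P_{\varepsilon_i}(v_i)$ and $P_{\varepsilon_j}(v_j)$; its length is $x_{ij}$. For distinct $i,j,k$, the face $\triangle ijk$ is the totally geodesic polygon in $\mathbb{H}^3$ bounded by $e_{ij},e_{jk},e_{ki}$ and the boundaries of $P_{\varepsilon_i}(v_i),P_{\varepsilon_j}(v_j),P_{\varepsilon_k}(v_k)$. If $v_i\in C^+$ (resp. $v_i\in S^+$), the intersections of $\partial P_{\varepsilon_i}(v_i)$ with the three faces $\triangle ijk,\triangle ikl,\triangle ilj$ are three Euclidean segments (resp. hyperbolic geodesic segments) bounding a Euclidean (resp. hyperbolic) triangle in $\partial P_{\varepsilon_i}(v_i)$, called the link $LK(v_i)$. If the faces $\triangle 234,\triangle 134,\triangle 124,\triangle 123$ together with the links $LK(v_i)$ for those $i$ with $v_i\in C^+\cup S^+$ bound an object in $\mathbb{H}^3$ of positive volume, this object is the generalized hyperbolic tetrahedron $T_{1234}$ determined by $v_1,v_2,v_3,v_4$. For $\{i,j,k,l\}=\{1,2,3,4\}$, $a_{ij}$ is the dihedral angle of $T_{1234}$ at $e_{ij}$ between the faces $\triangle ijk$ and $\triangle ijl$. With the types fixed, a generalized hyperbolic tetrahedron is determined by its edge lengths uniquely up to isometry, so the $a_{ij}$ are functions of the $x_{rs}$. The 15 types correspond to the choices of the types of the four points, up to relabelling. In the Jacobian matrix, the rows are indexed by the angles and the columns by the lengths, in the listed orders. *)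

theory Defs
  imports "HOL-Analysis.Analysis"
begin

section \<open>Minkowski space and the sets attached to a point\<close>

definition mink :: "real^4 \<Rightarrow> real^4 \<Rightarrow> real" where
  "mink X Y = X$1 * Y$1 + X$2 * Y$2 + X$3 * Y$3 - X$4 * Y$4"

definition H3 :: "(real^4) set" where
  "H3 = {X. mink X X = -1 \<and> X$4 > 0}"

definition Cplus :: "(real^4) set" where
  "Cplus = {X. mink X X = 0 \<and> X$4 > 0}"

definition Splus :: "(real^4) set" where
  "Splus = {X. mink X X = 1 \<and> X$4 > 0}"

definition vtype :: "real^4 \<Rightarrow> real" where
  "vtype v = - mink v v"

text \<open>The set \<open>P\<close> attached to \<open>v\<close>, and its interior relative to \<open>H3\<close>; the interior
  of a single point is empty. \<open>P\<close> and \<open>P_int\<close> are only used on \<open>H3 \<union> Cplus \<union> Splus\<close>.\<close>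

definition P :: "real^4 \<Rightarrow> (real^4) set" where
  "P v = (if v \<in> H3 then {v}
          else if v \<in> Cplus then {X \<in> H3. mink X v \<ge> -1/2}
          else {X \<in> H3. mink X v \<ge> 0})"

definition P_int :: "real^4 \<Rightarrow> (real^4) set" where
  "P_int v = (if v \<in> H3 then {}
              else if v \<in> Cplus then {X \<in> H3. mink X v > -1/2}
              else {X \<in> H3. mink X v > 0})"


section \<open>Hyperbolic distance, segments and volume\<close>

definition hdist :: "real^4 \<Rightarrow> real^4 \<Rightarrow> real" where
  "hdist X Y = arcosh (- mink X Y)"

definition hsetdist :: "(real^4) set \<Rightarrow> (real^4) set \<Rightarrow> real" where
  "hsetdist A B = Inf {hdist X Y | X Y. X \<in> A \<and> Y \<in> B}"

definition hsegment :: "real^4 \<Rightarrow> real^4 \<Rightarrow> (real^4) set" where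
  "hsegment p q = {X \<in> H3. \<exists>a b. 0 \<le> a \<and> 0 \<le> b \<and> X = a *\<^sub>R p + b *\<^sub>R q}"

text \<open>Volume in the chart of \<open>H3\<close> given by the first three coordinates: there the metric has
  matrix \<open>I - x x\<^sup>T / (1 + |x|\<^sup>2)\<close>, whose determinant is \<open>1 / (1 + |x|\<^sup>2)\<close>.\<close>

definition H3_lift :: "real^3 \<Rightarrow> real^4" where
  "H3_lift x = vector [x$1, x$2, x$3, sqrt (1 + x \<bullet> x)]"

definition hvolume :: "(real^4) set \<Rightarrow> ennreal" where
  "hvolume A = (\<integral>\<^sup>+ x. ennreal (1 / sqrt (1 + x \<bullet> x)) * indicator A (H3_lift x) \<partial>lborel)"


section \<open>Generalized hyperbolic tetrahedra\<close>

text \<open>The union of the segments realizing the distance between the two sets. For disjoint sets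
  there is exactly one such segment, except for two half spaces with \<open>mink (v i) (v j) = -1\<close>:
  their boundary planes meet at infinity, and there is none.\<close>

definition edge :: "(4 \<Rightarrow> real^4) \<Rightarrow> 4 \<Rightarrow> 4 \<Rightarrow> (real^4) set" where
  "edge v i j = \<Union> {hsegment p q | p q. p \<in> P (v i) \<and> q \<in> P (v j) \<and>
                                         hdist p q = hsetdist (P (v i)) (P (v j))}"

definition edge_length :: "(4 \<Rightarrow> real^4) \<Rightarrow> 4 \<Rightarrow> 4 \<Rightarrow> real" where
  "edge_length v i j = hsetdist (P (v i)) (P (v j))"

text \<open>The part of \<open>H3\<close> in the simplicial cone over the \<open>v i\<close>, \<open>i \<in> I\<close>, truncated along the
  boundaries of the sets \<open>P (v i)\<close>. For \<open>I = {i, j, k}\<close> the sides of the cone lie on the geodesics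
  through the three edges; for \<open>I = UNIV\<close> they lie on the planes of the four faces.\<close>

definition truncated_cone :: "(4 \<Rightarrow> real^4) \<Rightarrow> 4 set \<Rightarrow> (real^4) set" where
  "truncated_cone v I =
     {X \<in> H3. \<exists>a. (\<forall>i\<in>I. 0 \<le> a i) \<and> X = (\<Sum>i\<in>I. a i *\<^sub>R v i)} - (\<Union>i\<in>I. P_int (v i))"

definition tet_face :: "(4 \<Rightarrow> real^4) \<Rightarrow> 4 \<Rightarrow> 4 \<Rightarrow> 4 \<Rightarrow> (real^4) set" where
  "tet_face v i j k = truncated_cone v {i, j, k}"

definition tetrahedron :: "(4 \<Rightarrow> real^4) \<Rightarrow> (real^4) set" where
  "tetrahedron v = truncated_cone v UNIV"

definition tet_link :: "(4 \<Rightarrow> real^4) \<Rightarrow> 4 \<Rightarrow> (real^4) set" where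
  "tet_link v i = tetrahedron v \<inter> (P (v i) - P_int (v i))"

definition gen_hyp_tetrahedron :: "(4 \<Rightarrow> real^4) \<Rightarrow> bool" where
  "gen_hyp_tetrahedron v \<longleftrightarrow>
     (\<forall>i. v i \<in> H3 \<union> Cplus \<union> Splus) \<and>
     (\<forall>i j. i \<noteq> j \<longrightarrow> P (v i) \<inter> P (v j) = {}) \<and>
     (\<forall>i j. i \<noteq> j \<longrightarrow> edge v i j \<noteq> {}) \<and>
     (top_of_set H3) frontier_of (tetrahedron v)
       \<subseteq> \<Union> {tet_face v i j k | i j k. i \<noteq> j \<and> j \<noteq> k \<and> i \<noteq> k} \<union>
         \<Union> {tet_link v i | i. v i \<in> Cplus \<union> Splus} \<and>
     hvolume (tetrahedron v) > 0"


section \<open>Dihedral angles\<close>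

text \<open>\<open>u\<close> is the unit tangent vector at \<open>X\<close> that is orthogonal to the geodesic segment \<open>E\<close>
  through \<open>X\<close> and points into \<open>F\<close>.\<close>

definition inward_normal :: "(real^4) set \<Rightarrow> (real^4) set \<Rightarrow> real^4 \<Rightarrow> real^4 \<Rightarrow> bool" where
  "inward_normal E F X u \<longleftrightarrow>
     mink X u = 0 \<and> mink u u = 1 \<and> (\<forall>Y\<in>E. mink Y u = 0) \<and>
     (\<exists>\<delta>>0. \<forall>t. 0 < t \<and> t < \<delta> \<longrightarrow> cosh t *\<^sub>R X + sinh t *\<^sub>R u \<in> F)"

definition dihedral_angle :: "(4 \<Rightarrow> real^4) \<Rightarrow> 4 \<Rightarrow> 4 \<Rightarrow> real" where
  "dihedral_angle v i j =
     (THE \<theta>. \<exists>k l X u u'. {i, j, k, l} = UNIV \<and> X \<in> edge v i j \<and>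
        inward_normal (edge v i j) (tet_face v i j k) X u \<and>
        inward_normal (edge v i j) (tet_face v i j l) X u' \<and>
        \<theta> = arccos (mink u u'))"


section \<open>Angles as functions of lengths\<close>

definition sextuple :: "(4 \<Rightarrow> 4 \<Rightarrow> real) \<Rightarrow> real^6" where
  "sextuple f = vector [f 1 2, f 1 3, f 1 4, f 2 3, f 2 4, f 3 4]"

definition lengths :: "(4 \<Rightarrow> real^4) \<Rightarrow> real^6" where
  "lengths v = sextuple (edge_length v)"

definition angles :: "(4 \<Rightarrow> real^4) \<Rightarrow> real^6" where
  "angles v = sextuple (dihedral_angle v)"

definition angles_of_lengths :: "(4 \<Rightarrow> real) \<Rightarrow> real^6 \<Rightarrow> real^6" where
  "angles_of_lengths \<epsilon> x =
     (THE a. \<exists>v. gen_hyp_tetrahedron v \<and> (\<forall>i. vtype (v i) = \<epsilon> i) \<and>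
                 lengths v = x \<and> angles v = a)"


section \<open>Gram matrix and the matrices of the Jacobian formula\<close>

definition gram :: "(4 \<Rightarrow> real^4) \<Rightarrow> real^4^4" where
  "gram v = (\<chi> i j. mink (v i) (v j))"

text \<open>The increasing enumeration of \<open>{1, 2, 3, 4} - {i}\<close>; spelled out, because \<open>4 = 0\<close> is the
  least element of the type \<open>4\<close>.\<close>

definition skip :: "4 \<Rightarrow> 3 \<Rightarrow> 4" where
  "skip i m = (if m = 1 then (if i = 1 then 2 else 1)
               else if m = 2 then (if i = 1 \<or> i = 2 then 3 else 2)
               else (if i = 4 then 3 else 4))"

definition delete_row_col :: "real^4^4 \<Rightarrow> 4 \<Rightarrow> real^3^3" where
  "delete_row_col A i = (\<chi> r s. A $ skip i r $ skip i s)"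

definition w_coeff :: "(4 \<Rightarrow> 4 \<Rightarrow> real) \<Rightarrow> 4 \<Rightarrow> 4 \<Rightarrow> 4 \<Rightarrow> 4 \<Rightarrow> real" where
  "w_coeff a i j k l =
     (cos (a i j) * cos (a j k) * cos (a k i) + cos (a i j) * cos (a j l) * cos (a l i)
      + cos (a i k) * cos (a j l) + cos (a i l) * cos (a j k)) / (sin (a i j))\<^sup>2"

definition D_mat :: "(4 \<Rightarrow> 4 \<Rightarrow> real) \<Rightarrow> real^6^6" where
  "D_mat a = (\<chi> r s. if r = s then sextuple (\<lambda>i j. sin (a i j)) $ r else 0)"

definition M_mat :: "(4 \<Rightarrow> 4 \<Rightarrow> real) \<Rightarrow> real^6^6" where
  "M_mat a = vector
    [vector [w_coeff a 1 2 3 4, - cos (a 2 3), - cos (a 2 4), - cos (a 1 3), - cos (a 1 4), 1],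
     vector [- cos (a 2 3), w_coeff a 1 3 2 4, - cos (a 3 4), - cos (a 1 2), 1, - cos (a 1 4)],
     vector [- cos (a 2 4), - cos (a 3 4), w_coeff a 1 4 2 3, 1, - cos (a 1 2), - cos (a 1 3)],
     vector [- cos (a 1 3), - cos (a 1 2), 1, w_coeff a 2 3 1 4, - cos (a 3 4), - cos (a 2 4)],
     vector [- cos (a 1 4), 1, - cos (a 1 2), - cos (a 3 4), w_coeff a 2 4 1 3, - cos (a 2 3)],
     vector [1, - cos (a 1 4), - cos (a 1 3), - cos (a 2 4), - cos (a 2 3), w_coeff a 3 4 1 2]]"

definition jacobian_mat :: "(4 \<Rightarrow> real^4) \<Rightarrow> real^6^6" where
  "jacobian_mat v =
     (let G = gram v; a = dihedral_angle v in
      sqrt ((\<Prod>i\<in>UNIV. det (delete_row_col G i)) / (- (det G ^ 3))) *\<^sub>R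
        (D_mat a ** M_mat a ** D_mat a))"

end

theory Submission
  imports Defs
begin

text \<open>Null vectors \<open>m, n\<close> with \<open>mink m n = -1/2\<close> can be chosen in the plane of \<open>v i, v j\<close> so that
  \<open>v i = n + \<epsilon> i m\<close> and \<open>v j = e\<^sup>x m + \<epsilon> j e\<^sup>-\<^sup>x n\<close>, and the edge is \<open>t \<mapsto> e\<^sup>t m + e\<^sup>-\<^sup>t n\<close>, \<open>0 \<le> t \<le> x\<close>.
  Hence, for all types, \<open>mink (v i) (v j) = - (e\<^sup>x + \<epsilon> i \<epsilon> j e\<^sup>-\<^sup>x) / 2\<close> with \<open>x\<close> the edge length, and
  disjointness amounts to \<open>x > 0\<close>; positive volume amounts to linear independence of the \<open>v i\<close>. These
  conditions are open in the Gram matrix \<open>G\<close>, and a nearby \<open>G\<close> is realized by nearby points, so the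
  lengths vary freely.

  If \<open>H\<close> is the inverse of \<open>G\<close>, i.e. the Gram matrix of the dual basis, then
  \<open>cos (a i j) = - H k l / sqrt (H k k * H l l)\<close>. The Jacobian now follows from \<open>dH = - H dG H\<close> and
  Jacobi's identity for the complementary 2x2 minors of \<open>G\<close> and \<open>H\<close>, which turns
  \<open>dG r s / dx r s\<close> into a multiple of \<open>sin (a r s)\<close>.\<close>

section \<open>Minkowski space\<close>

text \<open>The map to be differentiated, \<open>angles_of_lengths\<close>, is a definite
  description. So for every length vector near the given one a tetrahedron has to exist, and all
  tetrahedra with these lengths must have the same angles. This is why tetrahedra are characterized
  in both directions: the definition yields Gram entries and a dual basis, and conversely these
  yield disjointness, edges, frontier and volume, which can thus be verified for perturbed points.
  The shape of the Jacobian: \<open>dG r s / dx r s\<close> is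
  \<open>- sqrt (- det G) * sqrt (H k k * H l l) * sin (a r s)\<close>, with \<open>k, l\<close> the
  other two indices. In \<open>H dG H\<close> the entries of \<open>H\<close> are minus cosines
  times square roots of diagonal entries of \<open>H\<close>; those with indices \<open>r, s\<close>
  complete the root to a product over all four indices. Hence one scalar factor serves all edges,
  and \<open>sin (a r s)\<close> is the column factor. The derivative of the normalized entry of
  \<open>H\<close> carries \<open>(sin (a i j))\<^sup>2\<close>; \<open>arccos\<close> cancels one
  sine, and the other is the row factor.\<close>

lemma mink_commute: "mink X Y = mink Y X"
  by (simp add: mink_def)

interpretation mink: bounded_bilinear mink
proof -
  have "bilinear mink"
    by (auto simp: bilinear_def mink_def linear_iff algebra_simps)
  then show "bounded_bilinear mink"
    by (simp add: bilinear_conv_bounded_bilinear)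
qed

lemmas mink_linear = mink.add_left mink.add_right mink.diff_left mink.diff_right
  mink.minus_left mink.minus_right mink.scaleR_left mink.scaleR_right

definition gen_points :: "(real^4) set" where
  "gen_points = H3 \<union> Cplus \<union> Splus"

lemma mem_gen_points_iff: "v \<in> gen_points \<longleftrightarrow> v $ 4 > 0 \<and> vtype v \<in> {1, 0, -1}"
  by (auto simp: gen_points_def H3_def Cplus_def Splus_def vtype_def)

lemma mink_self: "mink v v = - vtype v"
  by (simp add: vtype_def)

definition spat :: "real^4 \<Rightarrow> real^3" where
  "spat X = vector [X $ 1, X $ 2, X $ 3]"

lemma mink_spat: "mink X Y = spat X \<bullet> spat Y - X $ 4 * Y $ 4"
  by (simp add: mink_def spat_def inner_vec_def sum_3)

lemma spat_eq_0_iff: "spat X = 0 \<longleftrightarrow> X $ 1 = 0 \<and> X $ 2 = 0 \<and> X $ 3 = 0"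
  by (simp add: spat_def vec_eq_iff forall_3)

text \<open>Cauchy-Schwarz for the spatial parts: orthogonality gives
  \<open>s \<bullet> t = X $ 4 * w $ 4\<close>, and \<open>X\<close> timelike gives
  \<open>s \<bullet> s < (X $ 4)\<^sup>2\<close>. This is the main source of positivity below;
  points of \<open>H3\<close> serve as \<open>X\<close>.\<close>

lemma mink_orth_timelike_pos:
  assumes "mink X X < 0" "mink X w = 0" "w \<noteq> 0"
  shows "mink w w > 0"
proof -
  define s t where "s = spat X" and "t = spat w"
  have X: "s \<bullet> s < (X $ 4)\<^sup>2" and w: "s \<bullet> t = X $ 4 * w $ 4"
    using assms by (simp_all add: mink_spat s_def t_def power2_eq_square)
  have X0: "(X $ 4)\<^sup>2 > 0"
    using X inner_ge_zero[of s] by linarith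
  have CS: "(X $ 4)\<^sup>2 * (w $ 4)\<^sup>2 \<le> (s \<bullet> s) * (t \<bullet> t)"
    using Cauchy_Schwarz_ineq[of s t] by (simp add: w power_mult_distrib)
  have t: "t \<noteq> 0"
  proof
    assume "t = 0"
    then have "w $ 4 = 0" using w X0 by auto
    then show False
      using \<open>t = 0\<close> \<open>w \<noteq> 0\<close> spat_eq_0_iff[of w] by (simp add: t_def vec_eq_iff forall_4)
  qed
  then have "(s \<bullet> s) * (t \<bullet> t) < (X $ 4)\<^sup>2 * (t \<bullet> t)"
    using X by (simp add: mult_strict_right_mono)
  with CS have "(X $ 4)\<^sup>2 * (w $ 4)\<^sup>2 < (X $ 4)\<^sup>2 * (t \<bullet> t)" by linarith
  then have "(w $ 4)\<^sup>2 < t \<bullet> t"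
    using X0 by simp
  then show ?thesis
    by (simp add: mink_spat t_def power2_eq_square)
qed

lemma mink_orth_timelike_nonneg:
  assumes "mink X X < 0" "mink X w = 0"
  shows "mink w w \<ge> 0"
  using mink_orth_timelike_pos[OF assms] by (cases "w = 0") (auto simp: mink.zero_left)

text \<open>The vector \<open>?y\<close> is \<open>mink w w\<close> times the part of
  \<open>u\<close> orthogonal to \<open>w\<close>; its square is \<open>mink w w\<close> times the
  Gram determinant of \<open>u, w\<close>. Independence keeps it nonzero.\<close>

lemma mink_orth_timelike_CS_less:
  assumes X: "mink X X < 0" and orth: "mink X u = 0" "mink X w = 0"
    and indep: "\<And>a b. a *\<^sub>R u + b *\<^sub>R w = 0 \<Longrightarrow> a = 0 \<and> b = 0"
  shows "(mink u w)\<^sup>2 < mink u u * mink w w"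
proof -
  let ?y = "mink w w *\<^sub>R u - mink u w *\<^sub>R w"
  have "w \<noteq> 0" using indep[of 0 1] by auto
  then have ww: "mink w w > 0"
    using mink_orth_timelike_pos X orth by blast
  have "?y \<noteq> 0"
    using indep[of "mink w w" "- mink u w"] ww by auto
  moreover have "mink X ?y = 0"
    using orth by (simp add: mink_linear)
  ultimately have "0 < mink ?y ?y"
    using mink_orth_timelike_pos X by blast
  also have "mink ?y ?y = mink w w * (mink u u * mink w w - (mink u w)\<^sup>2)"
    by (simp add: mink_linear mink_commute[of w u] algebra_simps power2_eq_square)
  finally show ?thesis
    using ww by (simp add: zero_less_mult_iff)
qed

lemma mink_orth_timelike_CS:
  assumes X: "mink X X < 0" and orth: "mink X u = 0" "mink X w = 0"
  shows "(mink u w)\<^sup>2 \<le> mink u u * mink w w"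
proof (cases "w = 0")
  case True
  then show ?thesis by (simp add: mink.zero_right)
next
  case False
  let ?y = "mink w w *\<^sub>R u - mink u w *\<^sub>R w"
  have ww: "mink w w > 0"
    using mink_orth_timelike_pos X orth False by blast
  have "mink X ?y = 0"
    using orth by (simp add: mink_linear)
  then have "0 \<le> mink ?y ?y"
    using mink_orth_timelike_nonneg X by blast
  also have "mink ?y ?y = mink w w * (mink u u * mink w w - (mink u w)\<^sup>2)"
    by (simp add: mink_linear mink_commute[of w u] algebra_simps power2_eq_square)
  finally show ?thesis
    using ww by (simp add: zero_le_mult_iff)
qed

lemma mink_future_neg:
  assumes "mink X X < 0" "X $ 4 > 0" "mink n n \<le> 0" "n $ 4 > 0"
  shows "mink X n < 0"
proof -
  have X: "spat X \<bullet> spat X < (X $ 4)\<^sup>2" and n: "spat n \<bullet> spat n \<le> (n $ 4)\<^sup>2"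
    using assms by (simp_all add: mink_spat power2_eq_square)
  have "(spat X \<bullet> spat n)\<^sup>2 \<le> (spat X \<bullet> spat X) * (spat n \<bullet> spat n)"
    by (rule Cauchy_Schwarz_ineq)
  also have "\<dots> \<le> (spat X \<bullet> spat X) * (n $ 4)\<^sup>2"
    using n by (simp add: mult_left_mono)
  also have "\<dots> < (X $ 4)\<^sup>2 * (n $ 4)\<^sup>2"
    using X assms by (simp add: mult_strict_right_mono)
  finally have "(spat X \<bullet> spat n)\<^sup>2 < (X $ 4 * n $ 4)\<^sup>2"
    by (simp add: power_mult_distrib)
  then have "spat X \<bullet> spat n < X $ 4 * n $ 4"
    using assms by (meson less_imp_le mult_nonneg_nonneg power2_less_imp_less)
  then show ?thesis by (simp add: mink_spat)
qed

lemma H3_D: "X \<in> H3 \<Longrightarrow> mink X X = -1" "X \<in> H3 \<Longrightarrow> X $ 4 > 0"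
  by (auto simp: H3_def)

lemma H3_mink_le:
  assumes "X \<in> H3" "Y \<in> H3"
  shows "mink X Y \<le> -1" and "mink X Y = -1 \<longleftrightarrow> X = Y"
proof -
  define m where "m = mink X Y"
  have XX: "mink X X = -1" and YY: "mink Y Y = -1"
    using assms by (auto simp: H3_def)
  have neg: "m < 0"
    using mink_future_neg[of X Y] assms by (auto simp: m_def H3_def)
  \<comment> \<open>The part of \<open>Y\<close> orthogonal to \<open>X\<close>. Its square
    \<open>m\<^sup>2 - 1\<close> is nonnegative and vanishes only for the zero vector.\<close>
  let ?w = "Y + m *\<^sub>R X"
  have YX: "mink Y X = m" and XY: "mink X Y = m"
    by (simp_all add: m_def mink_commute)
  have o: "mink X ?w = 0" and n: "mink ?w ?w = m\<^sup>2 - 1"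
    by (simp_all add: mink_linear XX YY XY YX power2_eq_square)
  have X: "mink X X < 0" by (simp add: XX)
  have "0 \<le> mink ?w ?w"
    by (rule mink_orth_timelike_nonneg[OF X o])
  then have "1\<^sup>2 \<le> (- m)\<^sup>2" unfolding n by simp
  then have "1 \<le> - m" using neg using power2_le_imp_le[of 1 "- m"] by linarith
  then show "mink X Y \<le> -1" by (simp add: m_def)
  show "mink X Y = -1 \<longleftrightarrow> X = Y"
  proof
    assume "mink X Y = -1"
    then have "m = -1" by (simp add: m_def)
    then have "\<not> mink ?w ?w > 0" unfolding n by simp
    then have "?w = 0"
      using mink_orth_timelike_pos[OF X o] by blast
    then show "X = Y" using \<open>m = -1\<close> by simp
  qed (use XX in auto)
qed

lemma H3_vtype: "X \<in> H3 \<Longrightarrow> vtype X = 1"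
  by (simp add: H3_def vtype_def)

text \<open>One inequality covers the three types in all later arguments. For \<open>v\<close> in
  \<open>H3\<close> the threshold is -1, which only \<open>X = v\<close> attains.\<close>

lemma P_eq:
  assumes "v \<in> gen_points"
  shows "P v = {X \<in> H3. mink X v \<ge> - (1 + vtype v) / 2}"
proof -
  consider "v \<in> H3" | "v \<in> Cplus" "v \<notin> H3" | "v \<in> Splus" "v \<notin> H3" "v \<notin> Cplus"
    using assms by (auto simp: gen_points_def)
  then show ?thesis
  proof cases
    case 1
    then show ?thesis
      using H3_mink_le[OF _ 1] H3_vtype[OF 1] 1
      by (auto simp: P_def mink_self intro: antisym)
  qed (auto simp: P_def vtype_def Cplus_def Splus_def)
qed

lemma P_int_eq:
  assumes "v \<in> gen_points"
  shows "P_int v = {X \<in> H3. mink X v > - (1 + vtype v) / 2}"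
proof -
  consider "v \<in> H3" | "v \<in> Cplus" "v \<notin> H3" | "v \<in> Splus" "v \<notin> H3" "v \<notin> Cplus"
    using assms by (auto simp: gen_points_def)
  then show ?thesis
  proof cases
    case 1
    then show ?thesis
      using H3_mink_le(1)[OF _ 1] H3_vtype[OF 1] 1 by (force simp: P_int_def not_less)
  qed (auto simp: P_int_def vtype_def Cplus_def Splus_def)
qed

section \<open>The segment between two of the sets\<close>

lemma vtype_cases: "v \<in> gen_points \<Longrightarrow> vtype v = 1 \<or> vtype v = 0 \<or> vtype v = -1"
  by (auto simp: mem_gen_points_iff)

lemma exp_diff_pos:
  fixes a y :: real
  assumes "\<bar>a\<bar> \<le> 1" "y > 0"
  shows "exp y - a * exp (- y) > 0"
proof -
  have "a * exp (- y) \<le> 1 * exp (- y)"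
    using assms by (intro mult_right_mono) auto
  also have "\<dots> < exp y" using assms by simp
  finally show ?thesis by simp
qed

lemma exp_diff_nonneg:
  fixes a y :: real
  assumes "\<bar>a\<bar> \<le> 1" "y \<ge> 0"
  shows "exp y - a * exp (- y) \<ge> 0"
  using exp_diff_pos[of a y] assms by (cases "y = 0") auto

lemma exp_sum_mono:
  fixes a y :: real
  assumes "\<bar>a\<bar> \<le> 1" "y > 0"
  shows "exp y + a * exp (- y) > 1 + a"
proof -
  have "a * exp (- y) < 1"
  proof -
    have "a * exp (- y) \<le> 1 * exp (- y)"
      using assms by (intro mult_right_mono) auto
    also have "\<dots> < 1" using assms by simp
    finally show ?thesis by simp
  qed
  \<comment> \<open>The product expands to \<open>exp y + a * exp (- y) - (1 + a)\<close>.\<close>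
  then have "(exp y - 1) * (1 - a * exp (- y)) > 0"
    using assms by (intro mult_pos_pos) auto
  moreover have "exp y * exp (- y) = 1" by (simp flip: exp_add)
  ultimately show ?thesis by (simp add: algebra_simps)
qed

lemma cosh_real_gt_1: "x > 0 \<Longrightarrow> cosh (x::real) > 1"
  using cosh_real_nonneg_less_iff[of 0 x] by simp

text \<open>The formula for the Gram entry is the hypothesis here, so that the common perpendicular,
  its minimality and the disjointness follow by computation. The way back from disjoint sets with an
  edge is \<open>disjoint_imp_edge_pair\<close>.\<close>

locale edge_pair =
  fixes v w :: "real^4" and x :: real
  assumes v: "v \<in> gen_points" and w: "w \<in> gen_points" and x: "x > 0"
    and vw: "mink v w = - (exp x + vtype v * vtype w * exp (- x)) / 2"
begin

text \<open>Determinant of the linear system that expresses \<open>v\<close> and \<open>w\<close>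
  through the null vectors \<open>n\<close> and \<open>m\<close>; the formulas for \<open>m\<close>
  and \<open>n\<close> are Cramer's rule.\<close>

definition \<Delta> :: real where
  "\<Delta> = exp x - vtype v * vtype w * exp (- x)"

text \<open>Null vectors with \<open>mink m n = -1/2\<close> spanning the plane of \<open>v\<close> and \<open>w\<close>; the common
  perpendicular is \<open>geo t\<close>, \<open>0 \<le> t \<le> x\<close>.\<close>

definition m :: "real^4" where
  "m = (1 / \<Delta>) *\<^sub>R (w - (vtype w * exp (- x)) *\<^sub>R v)"

definition n :: "real^4" where
  "n = (1 / \<Delta>) *\<^sub>R (exp x *\<^sub>R v - vtype v *\<^sub>R w)"

definition geo :: "real \<Rightarrow> real^4" where
  "geo t = exp t *\<^sub>R m + exp (- t) *\<^sub>R n"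

lemma vtype_abs: "\<bar>vtype v\<bar> \<le> 1" "\<bar>vtype w\<bar> \<le> 1" "\<bar>vtype v * vtype w\<bar> \<le> 1"
  using vtype_cases[OF v] vtype_cases[OF w] by auto

lemma \<Delta>_pos: "\<Delta> > 0"
  using exp_diff_pos[OF vtype_abs(3) x] by (simp add: \<Delta>_def)

lemma exp_mult: "exp x * exp (- x) = 1" "exp (- x) * exp x = 1"
  by (simp_all flip: exp_add)

lemma \<Delta>_scale:
  "\<Delta> *\<^sub>R m = w - (vtype w * exp (- x)) *\<^sub>R v" "\<Delta> *\<^sub>R n = exp x *\<^sub>R v - vtype v *\<^sub>R w"
  using \<Delta>_pos by (simp_all add: m_def n_def)

lemma mink_mm: "mink m m = 0"
proof -
  have "mink (w - (vtype w * exp (- x)) *\<^sub>R v) (w - (vtype w * exp (- x)) *\<^sub>R v) = 0"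
    unfolding mink_linear mink_self[of v] mink_self[of w] mink_commute[of w v] vw
    using exp_mult by (simp add: field_simps)
  then show ?thesis unfolding m_def mink.scaleR_left mink.scaleR_right by simp
qed

lemma mink_nn: "mink n n = 0"
proof -
  have "mink (exp x *\<^sub>R v - vtype v *\<^sub>R w) (exp x *\<^sub>R v - vtype v *\<^sub>R w) = 0"
    unfolding mink_linear mink_self[of v] mink_self[of w] mink_commute[of w v] vw
    using exp_mult by (simp add: field_simps)
  then show ?thesis unfolding n_def mink.scaleR_left mink.scaleR_right by simp
qed

lemma mink_mn: "mink m n = -1/2" "mink n m = -1/2"
proof -
  have "mink (w - (vtype w * exp (- x)) *\<^sub>R v) (exp x *\<^sub>R v - vtype v *\<^sub>R w) = - (\<Delta> * \<Delta>) / 2"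
    unfolding mink_linear mink_self[of v] mink_self[of w] mink_commute[of w v] vw \<Delta>_def
    using exp_mult by (simp add: field_simps)
  then show "mink m n = -1/2"
    using \<Delta>_pos unfolding m_def n_def mink.scaleR_left mink.scaleR_right
    by (simp add: field_simps)
  then show "mink n m = -1/2" by (simp add: mink_commute)
qed

lemmas mink_frame = mink_mm mink_nn mink_mn

lemma v_eq: "v = n + vtype v *\<^sub>R m"
proof -
  have "\<Delta> *\<^sub>R (n + vtype v *\<^sub>R m) = \<Delta> *\<^sub>R n + vtype v *\<^sub>R (\<Delta> *\<^sub>R m)"
    by (simp add: algebra_simps)
  also have "\<dots> = \<Delta> *\<^sub>R v"
    unfolding \<Delta>_scale by (simp add: \<Delta>_def algebra_simps)
  finally show ?thesis using \<Delta>_pos by simp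
qed

lemma w_eq: "w = exp x *\<^sub>R m + (vtype w * exp (- x)) *\<^sub>R n"
proof -
  have "\<Delta> *\<^sub>R (exp x *\<^sub>R m + (vtype w * exp (- x)) *\<^sub>R n)
      = exp x *\<^sub>R (\<Delta> *\<^sub>R m) + (vtype w * exp (- x)) *\<^sub>R (\<Delta> *\<^sub>R n)"
    by (simp add: algebra_simps)
  also have "\<dots> = \<Delta> *\<^sub>R w"
    unfolding \<Delta>_scale by (simp add: \<Delta>_def algebra_simps)
  finally show ?thesis using \<Delta>_pos by simp
qed

lemma mink_geo_geo: "mink (geo s) (geo t) = - cosh (s - t)"
  unfolding geo_def mink_linear mink_frame
  by (simp add: cosh_def add_divide_distrib flip: exp_add)

lemma mink_geo_v: "mink (geo t) v = - (exp t + vtype v * exp (- t)) / 2"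
  by (subst v_eq) (simp add: geo_def mink_linear mink_frame)

lemma mink_geo_w: "mink (geo t) w = - (exp (x - t) + vtype w * exp (t - x)) / 2"
  by (subst w_eq) (simp add: geo_def mink_linear mink_frame exp_diff exp_minus field_simps)

text \<open>For \<open>0 \<le> t \<le> x\<close> both coefficients are nonnegative, so the
  perpendicular lies in the cone over \<open>v\<close> and \<open>w\<close>. This links edges to
  \<open>truncated_cone\<close>.\<close>

lemma geo_eq:
  "geo t = ((exp (x - t) - vtype w * exp (t - x)) / \<Delta>) *\<^sub>R v
         + ((exp t - vtype v * exp (- t)) / \<Delta>) *\<^sub>R w"
  unfolding geo_def m_def n_def
  by (simp add: algebra_simps exp_diff exp_minus divide_inverse)

lemma geo_coeffs_pos:
  assumes "0 < t" "t < x"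
  obtains a b where "a > 0" "b > 0" "geo t = a *\<^sub>R v + b *\<^sub>R w"
proof
  show "(exp (x - t) - vtype w * exp (t - x)) / \<Delta> > 0"
    using exp_diff_pos[OF vtype_abs(2), of "x - t"] assms \<Delta>_pos by simp
  show "(exp t - vtype v * exp (- t)) / \<Delta> > 0"
    using exp_diff_pos[OF vtype_abs(1), of t] assms \<Delta>_pos by simp
qed (rule geo_eq)

lemma geo_H3:
  assumes "0 \<le> t" "t \<le> x"
  shows "geo t \<in> H3"
proof -
  let ?a = "exp (x - t) - vtype w * exp (t - x)" and ?b = "exp t - vtype v * exp (- t)"
  have v4: "v $ 4 > 0" and w4: "w $ 4 > 0"
    using v w by (auto simp: mem_gen_points_iff)
  have nn: "?a \<ge> 0" "?b \<ge> 0"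
    using exp_diff_nonneg[OF vtype_abs(2), of "x - t"] exp_diff_nonneg[OF vtype_abs(1), of t] assms
    by simp_all
  \<comment> \<open>At \<open>t = 0\<close> the coefficient \<open>?b\<close> is
    \<open>1 - vtype v\<close>, which is 0 for \<open>v\<close> in \<open>H3\<close>; there
    \<open>?a\<close> takes over.\<close>
  have "?a > 0 \<or> ?b > 0"
    using exp_diff_pos[OF vtype_abs(2), of "x - t"] exp_diff_pos[OF vtype_abs(1), of t] assms x
    by (cases "t = 0") auto
  then have "?a * v $ 4 + ?b * w $ 4 > 0"
    using nn v4 w4 by (auto intro: add_pos_nonneg add_nonneg_pos)
  then have "geo t $ 4 > 0"
    using \<Delta>_pos unfolding geo_eq by (simp flip: add_divide_distrib)
  moreover have "mink (geo t) (geo t) = -1"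
    by (simp add: mink_geo_geo)
  ultimately show ?thesis by (simp add: H3_def)
qed

lemma geo_0_P: "geo 0 \<in> P v"
  using geo_H3[of 0] x mink_geo_v[of 0] by (simp add: P_eq[OF v])

lemma geo_x_P: "geo x \<in> P w"
  using geo_H3[of x] x mink_geo_w[of x] by (simp add: P_eq[OF w])

text \<open>Hyperbolic interpolation between the endpoints, needed because \<open>hsegment\<close>
  is built from its endpoints and not from \<open>v\<close> and \<open>w\<close>.\<close>

lemma geo_eq_comb:
  "geo t = (sinh (x - t) / sinh x) *\<^sub>R geo 0 + (sinh t / sinh x) *\<^sub>R geo x"
proof -
  have s: "sinh x > 0" using x by simp
  have "sinh x * exp t = sinh (x - t) + sinh t * exp x"
    "sinh x * exp (- t) = sinh (x - t) + sinh t * exp (- x)"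
    by (simp_all add: sinh_def exp_diff exp_minus field_simps)
  then have "exp t = sinh (x - t) / sinh x + sinh t / sinh x * exp x"
    "exp (- t) = sinh (x - t) / sinh x + sinh t / sinh x * exp (- x)"
    using s by (simp_all add: field_simps)
  then show ?thesis
    unfolding geo_def by (simp add: scaleR_add_left scaleR_add_right add_ac)
qed

lemma m_n_geo:
  "m = (1 / (2 * sinh x)) *\<^sub>R (geo x - exp (- x) *\<^sub>R geo 0)"
  "n = (1 / (2 * sinh x)) *\<^sub>R (exp x *\<^sub>R geo 0 - geo x)"
proof -
  have s: "2 * sinh x \<noteq> 0" using x by simp
  have "geo x - exp (- x) *\<^sub>R geo 0 = (2 * sinh x) *\<^sub>R m"
    "exp x *\<^sub>R geo 0 - geo x = (2 * sinh x) *\<^sub>R n"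
    by (simp_all add: geo_def sinh_def algebra_simps)
  then show "m = (1 / (2 * sinh x)) *\<^sub>R (geo x - exp (- x) *\<^sub>R geo 0)"
    "n = (1 / (2 * sinh x)) *\<^sub>R (exp x *\<^sub>R geo 0 - geo x)"
    using s by simp_all
qed

text \<open>Here \<open>\<alpha>, \<beta>\<close> are the coordinates of a point of
  \<open>P v\<close> along \<open>m, n\<close>. Its foot on the geodesic is the \<open>geo t\<close>
  with \<open>exp (2 * t) = \<alpha> / \<beta>\<close>, so the conclusion places the foot at
  \<open>t \<le> 0\<close>, not beyond the start of the edge.\<close>

lemma end_coordinate_le:
  fixes \<alpha> \<beta> \<epsilon> :: real
  assumes "\<epsilon> = 1 \<or> \<epsilon> = 0 \<or> \<epsilon> = -1" "\<beta> > 0" "\<alpha> * \<beta> \<ge> 1" "\<alpha> + \<epsilon> * \<beta> \<le> 1 + \<epsilon>"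
  shows "\<alpha> \<le> \<beta>"
  using assms(1)
proof (elim disjE)
  assume e: "\<epsilon> = 1"
  have "\<alpha> > 0" using assms by (smt (verit) mult_nonpos_nonneg)
  then have "(\<alpha> + \<beta>)\<^sup>2 \<le> 2\<^sup>2"
    using assms e by (intro power_mono) auto
  then have "(\<alpha> - \<beta>)\<^sup>2 \<le> 0"
    using assms(3) by (simp add: power2_eq_square algebra_simps)
  then show ?thesis by simp
next
  assume e: "\<epsilon> = 0"
  show ?thesis
  proof (rule ccontr)
    assume "\<not> \<alpha> \<le> \<beta>"
    then have "\<alpha> * \<beta> < 1 * 1"
      using assms e by (intro mult_le_less_imp_less) auto
    with assms show False by simp
  qed
qed (use assms in auto)

text \<open>Split \<open>a\<close> and \<open>b\<close> into parts in the plane of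
  \<open>m, n\<close> and parts \<open>a', b'\<close> orthogonal to it. The plane parts contribute
  \<open>(A * E + B * F) / 2\<close> to \<open>- mink a b\<close>, and \<open>c = mink a' b'\<close>
  is subtracted. Cauchy-Schwarz gives \<open>c \<le> S - 1\<close> with \<open>S\<close> the
  geometric mean of \<open>A\<close> and \<open>B\<close>. As the feet lie outside the open segment,
  \<open>B \<le> A\<close>, and the total is at least \<open>S * (cosh x - 1) + 1\<close> with
  \<open>S \<ge> 1\<close>.\<close>

lemma minimal:
  assumes a: "a \<in> P v" and b: "b \<in> P w"
  shows "cosh x \<le> - mink a b"
    and "- mink a b = cosh x \<Longrightarrow> a = geo 0 \<and> b = geo x"
proof -
  define E F where "E = exp x" and "F = exp (- x)"
  have EF: "E * F = 1" "F * E = 1" "F < E" "F > 0" "E > 0"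
    using exp_mult x by (auto simp: E_def F_def)
  have EFz: "E * (F * z) = z" for z
    using EF(1) by (metis mult.assoc mult_1)
  define \<alpha> \<beta> where "\<alpha> = -2 * mink a n" and "\<beta> = -2 * mink a m"
  \<comment> \<open>The factors \<open>F\<close> and \<open>E\<close> refer \<open>b\<close> to the
    end \<open>geo x\<close>, for which \<open>\<alpha>' = \<beta>' = 1\<close>.\<close>
  define \<alpha>' \<beta>' where "\<alpha>' = -2 * F * mink b n" and "\<beta>' = -2 * E * mink b m"
  define a' b' where "a' = a - \<alpha> *\<^sub>R m - \<beta> *\<^sub>R n"
    and "b' = b - (\<alpha>' * E) *\<^sub>R m - (\<beta>' * F) *\<^sub>R n"
  have aH: "a \<in> H3" "mink a v \<ge> - (1 + vtype v) / 2" and bH: "b \<in> H3" "mink b w \<ge> - (1 + vtype w) / 2"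
    using a b by (auto simp: P_eq v w)
  note comms = mink_commute[of m a] mink_commute[of n a] mink_commute[of m b] mink_commute[of n b]
  have an: "mink a n = - \<alpha> / 2" "mink a m = - \<beta> / 2"
    by (simp_all add: \<alpha>_def \<beta>_def)
  have bn: "mink b n = - \<alpha>' * E / 2" "mink b m = - \<beta>' * F / 2"
    using EF by (simp_all add: \<alpha>'_def \<beta>'_def)
  have aa: "mink a a = -1" and bb: "mink b b = -1"
    using aH bH by (auto simp: H3_def)
  have g0: "mink (geo 0) (geo 0) < 0"
    by (simp add: mink_geo_geo)
  have ga': "mink (geo 0) a' = 0"
    by (simp add: geo_def a'_def mink_linear mink_frame comms an)
  have gb': "mink (geo 0) b' = 0"
    by (simp add: geo_def b'_def mink_linear mink_frame comms bn)
  have a'a': "mink a' a' = \<alpha> * \<beta> - 1"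
    by (simp add: a'_def mink_linear mink_frame comms an aa field_simps)
  have b'b': "mink b' b' = \<alpha>' * \<beta>' - 1"
    using EF by (simp add: b'_def mink_linear mink_frame comms bn bb field_simps)
  define c where "c = mink a' b'"
  have c: "- mink a b = (\<beta> * \<alpha>' * E + \<alpha> * \<beta>' * F) / 2 - c"
    by (simp add: c_def a'_def b'_def mink_linear mink_frame comms an bn field_simps)
  have p1: "\<alpha> * \<beta> \<ge> 1" and q1: "\<alpha>' * \<beta>' \<ge> 1"
    using mink_orth_timelike_nonneg[OF g0 ga'] mink_orth_timelike_nonneg[OF g0 gb']
    unfolding a'a' b'b' by simp_all
  have "\<alpha> + \<beta> > 0"
  proof -
    have "mink a (geo 0) \<le> -1"
      using H3_mink_le(1)[of a "geo 0"] aH geo_H3[of 0] x by simp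
    then show ?thesis by (simp add: geo_def mink_linear an)
  qed
  then have pos: "\<alpha> > 0" "\<beta> > 0"
    using p1 by (smt (verit) mult_nonpos_nonneg mult_nonneg_nonpos)+
  have "\<alpha>' + \<beta>' > 0"
  proof -
    have "mink b (geo x) \<le> -1"
      using H3_mink_le(1)[of b "geo x"] bH geo_H3[of x] x by simp
    then show ?thesis
      unfolding geo_def mink_linear bn by (simp add: E_def[symmetric] F_def[symmetric] EFz algebra_simps)
  qed
  then have pos': "\<alpha>' > 0" "\<beta>' > 0"
    using q1 by (smt (verit) mult_nonpos_nonneg mult_nonneg_nonpos)+
  have "mink a v = - (\<alpha> + vtype v * \<beta>) / 2"
    by (subst v_eq) (simp add: mink_linear an field_simps)
  then have ab: "\<alpha> \<le> \<beta>"
    using aH(2) end_coordinate_le[OF vtype_cases[OF v] pos(2) p1] by simp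
  have "mink b w = - (\<beta>' + vtype w * \<alpha>') / 2"
    by (subst w_eq) (simp add: mink_linear bn E_def[symmetric] F_def[symmetric] EFz field_simps)
  then have ab': "\<beta>' \<le> \<alpha>'"
    using bH(2) end_coordinate_le[OF vtype_cases[OF w] pos'(1), of "\<beta>'"] q1
    by (simp add: mult.commute)
  define A B S where "A = \<beta> * \<alpha>'" and "B = \<alpha> * \<beta>'" and "S = sqrt (A * B)"
  have AB: "B \<le> A" "A > 0" "B > 0"
    unfolding A_def B_def using ab ab' pos pos' by (auto intro: mult_mono)
  have AB_eq: "A * B = (\<alpha> * \<beta>) * (\<alpha>' * \<beta>')"
    by (simp add: A_def B_def mult_ac)
  have AB1: "A * B \<ge> 1"
    using mult_mono[OF p1 q1] p1 unfolding AB_eq by simp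
  have S: "S\<^sup>2 = A * B" "S \<ge> 1" "2 * S \<le> A + B"
    using AB1 AB arith_geo_mean_sqrt[of A B] by (simp_all add: S_def)
  have pq: "2 * S \<le> \<alpha> * \<beta> + \<alpha>' * \<beta>'"
    using arith_geo_mean_sqrt[of "\<alpha> * \<beta>" "\<alpha>' * \<beta>'"] p1 q1 by (simp add: S_def AB_eq)
  have "c\<^sup>2 \<le> (\<alpha> * \<beta> - 1) * (\<alpha>' * \<beta>' - 1)"
    using mink_orth_timelike_CS[OF g0 ga' gb'] unfolding a'a' b'b' c_def .
  also have "\<dots> = S\<^sup>2 - (\<alpha> * \<beta> + \<alpha>' * \<beta>') + 1"
    unfolding S(1) AB_eq by (simp add: algebra_simps)
  also have "\<dots> \<le> (S - 1)\<^sup>2"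
    using pq by (simp add: power2_eq_square algebra_simps)
  finally have cS: "c \<le> S - 1"
    using S(2) by (meson diff_ge_0_iff_ge power2_le_imp_le)
  have SB: "S \<ge> B"
  proof -
    have "B\<^sup>2 \<le> S\<^sup>2" unfolding S(1) using AB by (simp add: power2_eq_square)
    then show ?thesis using S(2) power2_le_imp_le[of B S] by linarith
  qed
  \<comment> \<open>\<open>S - B \<le> A - S\<close> is the inequality of the means; the larger gap
    carries the larger weight \<open>E\<close>.\<close>
  have "(S - B) * F \<le> (A - S) * F"
    using S EF by (intro mult_right_mono) auto
  also have "\<dots> \<le> (A - S) * E"
    using S SB EF by (intro mult_left_mono) auto
  finally have 1: "S * (E + F) \<le> A * E + B * F"
    by (simp add: algebra_simps)
  have cosh: "cosh x = (E + F) / 2"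
    by (simp add: cosh_def E_def F_def)
  have cosh1: "cosh x > 1" by (rule cosh_real_gt_1[OF x])
  have c2: "- mink a b = (A * E + B * F) / 2 - c"
    unfolding c A_def B_def by simp
  have 2: "S * (cosh x - 1) + 1 \<le> - mink a b"
  proof -
    have "S * ((E + F) / 2 - 1) = S * (E + F) / 2 - S" by (simp add: algebra_simps)
    then show ?thesis using 1 cS unfolding c2 cosh by argo
  qed
  have 3: "cosh x - 1 \<le> S * (cosh x - 1)"
    using S cosh1 by simp
  show "cosh x \<le> - mink a b" using 2 3 by argo
  assume eq: "- mink a b = cosh x"
  then have "S * (cosh x - 1) = cosh x - 1" using 2 3 by argo
  \<comment> \<open>From here equality propagates: both products \<open>\<alpha> * \<beta>\<close>
    and \<open>\<alpha>' * \<beta>'\<close> are 1, so \<open>a'\<close> and \<open>b'\<close>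
    vanish, then \<open>A = B = 1\<close>, and all four coordinates are 1.\<close>
  then have S1: "S = 1" using cosh1 x by simp
  have pq1: "(\<alpha> * \<beta>) * (\<alpha>' * \<beta>') = 1"
    using S(1) S1 AB_eq by simp
  have "\<alpha> * \<beta> \<le> (\<alpha> * \<beta>) * (\<alpha>' * \<beta>')" "\<alpha>' * \<beta>' \<le> (\<alpha> * \<beta>) * (\<alpha>' * \<beta>')"
    using p1 q1 mult_left_mono[OF q1, of "\<alpha> * \<beta>"] mult_right_mono[OF p1, of "\<alpha>' * \<beta>'"] by auto
  then have p: "\<alpha> * \<beta> = 1" and q: "\<alpha>' * \<beta>' = 1" using pq1 p1 q1 by linarith+
  have "a' = 0"
    using mink_orth_timelike_pos[OF g0 ga'] a'a' p by auto
  have "b' = 0"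
    using mink_orth_timelike_pos[OF g0 gb'] b'b' q by auto
  have "c = 0" by (simp add: c_def \<open>a' = 0\<close> mink.zero_left)
  then have AE: "A * E + B * F = E + F"
    using eq unfolding c2 cosh by simp
  have "A * B = 1" using S(1) S1 by simp
  have "A = 1"
  proof (rule ccontr)
    assume "A \<noteq> 1"
    have "(A - 1) * E = (1 - B) * F" using AE by (simp add: algebra_simps)
    also have "\<dots> \<le> (A - 1) * F"
      using S S1 EF by (intro mult_right_mono) auto
    finally have "(A - 1) * (E - F) \<le> 0" by (simp add: algebra_simps)
    moreover have "A - 1 > 0" using \<open>A \<noteq> 1\<close> S S1 SB AB by linarith
    ultimately show False using EF by (simp add: mult_le_0_iff)
  qed
  then have "\<beta> * \<alpha>' = \<alpha> * \<beta>" unfolding A_def p by simp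
  then have "\<alpha>' = \<alpha>" using pos by (simp add: mult.commute)
  then have "\<beta>' = \<beta>" using p q pos by (metis mult_left_cancel less_irrefl)
  have "\<alpha> = \<beta>" using ab ab' \<open>\<alpha>' = \<alpha>\<close> \<open>\<beta>' = \<beta>\<close> by simp
  then have "\<alpha>\<^sup>2 = 1\<^sup>2" using p by (simp add: power2_eq_square)
  then have "\<alpha> = 1" using pos by (metis power2_eq_imp_eq less_imp_le zero_le_one)
  show "a = geo 0 \<and> b = geo x"
    using \<open>a' = 0\<close> \<open>b' = 0\<close> \<open>\<alpha> = 1\<close> \<open>\<alpha> = \<beta>\<close> \<open>\<beta>' = \<beta>\<close> \<open>\<alpha>' = \<alpha>\<close>
    by (simp add: a'_def b'_def geo_def E_def F_def algebra_simps)
qed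

lemma hdist_geo: "hdist (geo 0) (geo x) = x"
  using x by (simp add: hdist_def mink_geo_geo arcosh_cosh_real)

lemma hdist_ge:
  assumes "a \<in> P v" "b \<in> P w"
  shows "x \<le> hdist a b"
proof (rule ccontr)
  assume "\<not> ?thesis"
  then have "hdist a b < x" by simp
  have 1: "1 \<le> - mink a b"
    using minimal(1)[OF assms] cosh_real_ge_1[of x] by linarith
  have "cosh x \<le> cosh (hdist a b)"
    using minimal(1)[OF assms] 1 by (simp add: hdist_def)
  moreover have "hdist a b \<ge> 0" using 1 by (simp add: hdist_def)
  ultimately show False using \<open>hdist a b < x\<close> x
    by (simp add: cosh_real_nonneg_le_iff)
qed

lemma hsetdist_eq: "hsetdist (P v) (P w) = x"
  unfolding hsetdist_def
  by (rule cInf_eq_minimum) (use geo_0_P geo_x_P hdist_geo hdist_ge in \<open>force+\<close>)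

lemma hdist_eq_iff:
  assumes "a \<in> P v" "b \<in> P w"
  shows "hdist a b = hsetdist (P v) (P w) \<longleftrightarrow> a = geo 0 \<and> b = geo x"
proof
  assume "hdist a b = hsetdist (P v) (P w)"
  then have "cosh (arcosh (- mink a b)) = cosh x"
    by (simp add: hsetdist_eq hdist_def)
  moreover have "1 \<le> - mink a b"
    using minimal(1)[OF assms] cosh_real_ge_1[of x] by linarith
  ultimately show "a = geo 0 \<and> b = geo x"
    using minimal(2)[OF assms] by simp
qed (simp add: hsetdist_eq hdist_geo)

lemma P_disjoint: "P v \<inter> P w = {}"
proof -
  have False if "a \<in> P v" "a \<in> P w" for a
  proof -
    have "a \<in> H3" using that by (simp add: P_eq v)
    then have "cosh x \<le> 1" using minimal(1)[OF that] by (simp add: H3_def)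
    then show False using x cosh_real_gt_1[OF x] by simp
  qed
  then show ?thesis by auto
qed

lemma segments_eq:
  "\<Union> {hsegment p q | p q. p \<in> P v \<and> q \<in> P w \<and> hdist p q = hsetdist (P v) (P w)}
     = hsegment (geo 0) (geo x)"
proof -
  have "{hsegment p q | p q. p \<in> P v \<and> q \<in> P w \<and> hdist p q = hsetdist (P v) (P w)}
     = {hsegment (geo 0) (geo x)}"
    using hdist_eq_iff geo_0_P geo_x_P by blast
  then show ?thesis by simp
qed

lemma geo_in_segment:
  assumes "0 \<le> t" "t \<le> x"
  shows "geo t \<in> hsegment (geo 0) (geo x)"
proof -
  have "sinh (x - t) / sinh x \<ge> 0" "sinh t / sinh x \<ge> 0"
    using assms x by auto
  then show ?thesis
    using geo_H3[OF assms] geo_eq_comb[of t] unfolding hsegment_def by blast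
qed

lemma segment_span:
  assumes "X \<in> hsegment (geo 0) (geo x)"
  obtains a b where "X = a *\<^sub>R v + b *\<^sub>R w"
proof -
  obtain c d where "X = c *\<^sub>R geo 0 + d *\<^sub>R geo x"
    using assms by (auto simp: hsegment_def)
  moreover obtain a b where "geo 0 = a *\<^sub>R v + b *\<^sub>R w" using geo_eq by blast
  moreover obtain a' b' where "geo x = a' *\<^sub>R v + b' *\<^sub>R w" using geo_eq by blast
  ultimately have "X = (c * a + d * a') *\<^sub>R v + (c * b + d * b') *\<^sub>R w"
    by (simp add: algebra_simps)
  then show ?thesis by (rule that)
qed

lemma orth_segment_iff:
  "(\<forall>Y\<in>hsegment (geo 0) (geo x). mink Y u = 0) \<longleftrightarrow> mink v u = 0 \<and> mink w u = 0"
proof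
  assume *: "\<forall>Y\<in>hsegment (geo 0) (geo x). mink Y u = 0"
  then have "mink (geo 0) u = 0" "mink (geo x) u = 0"
    using geo_in_segment x by auto
  then have "mink m u = 0" "mink n u = 0"
    by (simp_all add: m_n_geo(1) m_n_geo(2) mink_linear)
  then show "mink v u = 0 \<and> mink w u = 0"
    by (subst v_eq, subst w_eq) (simp add: mink_linear)
next
  assume *: "mink v u = 0 \<and> mink w u = 0"
  show "\<forall>Y\<in>hsegment (geo 0) (geo x). mink Y u = 0"
  proof
    fix Y assume "Y \<in> hsegment (geo 0) (geo x)"
    then obtain a b where "Y = a *\<^sub>R v + b *\<^sub>R w" using segment_span by blast
    then show "mink Y u = 0" using * by (simp add: mink_linear)
  qed
qed

end

section \<open>Disjointness in terms of the Gram matrix\<close>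

definition hnormalize :: "real^4 \<Rightarrow> real^4" where
  "hnormalize Y = (1 / sqrt (- mink Y Y)) *\<^sub>R Y"

lemma hnormalize_H3:
  assumes "mink Y Y < 0" "Y $ 4 > 0"
  shows "hnormalize Y \<in> H3"
  using assms by (simp add: H3_def hnormalize_def mink_linear flip: power2_eq_square)

lemma mink_hnormalize: "mink (hnormalize Y) w = mink Y w / sqrt (- mink Y Y)"
  by (simp add: hnormalize_def mink_linear)

lemma mink_axis_4: "mink (axis 4 1) (axis 4 1) = -1" "(axis 4 1 :: real^4) $ 4 = 1"
  "mink (axis 4 1) w = - w $ 4"
  by (simp_all add: mink_def axis_def)

lemma P_meet_timelike:
  assumes "v \<in> gen_points" "w \<in> gen_points" "vtype v = 1" "mink v w \<ge> - (1 + vtype w) / 2"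
  shows "P v \<inter> P w \<noteq> {}"
proof -
  have "v \<in> H3" using assms(1,3) by (simp add: mem_gen_points_iff H3_def mink_self)
  then have "v \<in> P v \<inter> P w"
    using assms by (simp add: P_eq mink_self)
  then show ?thesis by auto
qed

lemma P_meet_null:
  assumes v: "v \<in> gen_points" and w: "w \<in> gen_points" and tv: "vtype v = 0" and tw: "vtype w = 0 \<or> vtype w = -1"
    and g: "mink v w \<ge> - 1 / 2"
  shows "P v \<inter> P w \<noteq> {}"
proof -
  have vv: "mink v v = 0" and v4: "v $ 4 > 0" and w4: "w $ 4 > 0"
    using v w tv by (auto simp: mem_gen_points_iff mink_self)
  have PI: "P v \<inter> P w \<noteq> {}"
    if "X \<in> H3" "mink X v \<ge> - 1 / 2" "mink X w \<ge> - (1 + vtype w) / 2" for X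
  proof -
    have "X \<in> P v \<inter> P w" using that by (simp add: P_eq v w tv)
    then show ?thesis by auto
  qed
  show ?thesis
  proof (cases "mink v w < 0")
    case True
    show ?thesis
    proof (cases "vtype w = 0")
      case w0: True
      \<comment> \<open>\<open>s *\<^sub>R (v + w)\<close> is the point on the geodesic between the
        two ideal points that is equally deep in both horoballs.\<close>
      define s where "s = 1 / sqrt (- 2 * mink v w)"
      let ?X = "s *\<^sub>R (v + w)"
      have ww: "mink w w = 0" by (simp add: mink_self w0)
      have s: "s > 0" "s * s = 1 / (- 2 * mink v w)" using True by (auto simp: s_def field_simps)
      have "mink ?X ?X = s * s * (2 * mink v w)"
        by (simp add: mink_linear vv ww mink_commute[of w v])
      also have "\<dots> = -1" unfolding s using True by (simp add: field_simps)
      finally have X: "?X \<in> H3" using v4 w4 s by (simp add: H3_def)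
      have "- mink v w * s = sqrt (- 2 * mink v w) / 2"
        using True real_sqrt_mult_self[of "- 2 * mink v w"] by (simp add: s_def field_simps)
      also have "\<dots> \<le> 1 / 2" using g by simp
      finally have "s * mink v w \<ge> - 1 / 2" by argo
      then show ?thesis
        by (intro PI[OF X]) (simp_all add: mink_linear vv ww w0 mink_commute[of w v])
    next
      case False
      with tw have w1: "vtype w = -1" by simp
      \<comment> \<open>Where the geodesic from the ideal point of \<open>v\<close> perpendicular to
        the boundary plane of \<open>w\<close> meets this plane; there
        \<open>mink ?X v = mink v w\<close>.\<close>
      let ?X = "w - (1 / mink v w) *\<^sub>R v"
      have X: "?X \<in> H3"
        using True v4 w4 by (simp add: H3_def mink_linear vv mink_self[of w] w1 mink_commute[of w v] field_simps)
          (smt (verit) mult_neg_pos)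
      show ?thesis
        using True g by (intro PI[OF X]) (simp_all add: mink_linear vv mink_self[of w] w1 mink_commute[of w v])
    qed
  next
    case g0: False
    obtain Z where Z: "Z \<in> H3" "vtype w = 0 \<or> mink Z w = 0"
    proof (cases "vtype w = 0")
      case True
      have "(axis 4 1 :: real^4) \<in> H3" by (simp add: H3_def mink_axis_4)
      then show ?thesis using that True by blast
    next
      case False
      with tw have w1: "mink w w = 1" by (simp add: mink_self)
      \<comment> \<open>The projection of \<open>axis 4 1\<close> to the hyperplane orthogonal to
        \<open>w\<close>.\<close>
      let ?Y = "axis 4 1 + w $ 4 *\<^sub>R w"
      have "mink ?Y ?Y = -1 - (w $ 4)\<^sup>2"
        by (simp add: mink_linear mink_axis_4 w1 mink_commute[of w "axis 4 1"] power2_eq_square)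
      also have "\<dots> < 0" by (smt (verit) zero_le_power2)
      finally have "hnormalize ?Y \<in> H3"
        using w4 by (intro hnormalize_H3) (auto simp: mink_axis_4(2) intro!: add_pos_nonneg)
      moreover have "mink (hnormalize ?Y) w = 0"
        by (simp add: mink_hnormalize mink_linear mink_axis_4 w1)
      ultimately show ?thesis using that by blast
    qed
    have Zv: "mink Z v < 0"
      using mink_future_neg[of Z v] Z v4 vv by (simp add: H3_def)
    \<comment> \<open>The point \<open>?X\<close> is \<open>Z\<close> moved towards the ideal point
      of \<open>v\<close>: \<open>\<mu>\<close> is small enough for both horoball bounds, and
      \<open>\<nu>\<close> is fixed by \<open>mink ?X ?X = -1\<close>. Because
      \<open>mink v w \<ge> 0\<close>, adding a multiple of \<open>v\<close> does not lower the
      product with \<open>w\<close>.\<close>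
    define \<mu> where "\<mu> = 1 / (1 + 2 * \<bar>mink Z v\<bar> + 2 * \<bar>mink Z w\<bar>)"
    define \<nu> where "\<nu> = (1 - \<mu>\<^sup>2) / (- 2 * \<mu> * mink Z v)"
    have \<mu>: "\<mu> > 0" "\<mu> \<le> 1" by (simp_all add: \<mu>_def add_pos_nonneg)
    have \<mu>v: "\<mu> * \<bar>mink Z v\<bar> \<le> 1 / 2" and \<mu>w: "\<mu> * \<bar>mink Z w\<bar> \<le> 1 / 2"
      by (simp_all add: \<mu>_def divide_le_eq add_pos_nonneg)
    have "\<mu>\<^sup>2 \<le> 1" using \<mu> by (simp add: power_le_one)
    then have \<nu>: "\<nu> \<ge> 0" using \<mu> Zv unfolding \<nu>_def
      by (intro divide_nonneg_nonneg) (simp_all add: mult_nonneg_nonpos)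
    have \<nu>2: "2 * \<nu> * \<mu> * mink Z v = \<mu>\<^sup>2 - 1"
      using \<mu> Zv by (simp add: \<nu>_def field_simps)
    let ?X = "\<nu> *\<^sub>R v + \<mu> *\<^sub>R Z"
    have "mink ?X ?X = 2 * \<nu> * \<mu> * mink Z v - \<mu>\<^sup>2"
      using H3_D[OF Z(1)] by (simp add: mink_linear vv mink_commute[of v Z] power2_eq_square algebra_simps)
    then have X: "?X \<in> H3"
      using \<nu>2 \<nu> \<mu> v4 H3_D(2)[OF Z(1)] by (auto simp: H3_def intro!: add_nonneg_pos)
    have "mink ?X v \<ge> - 1 / 2"
      using \<mu>v Zv by (simp add: mink_linear vv)
    moreover have "mink ?X w \<ge> - (1 + vtype w) / 2"
    proof -
      have "\<nu> * mink v w \<ge> 0" using \<nu> g0 by simp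
      moreover have "\<mu> * mink Z w \<ge> - (1 + vtype w) / 2"
      proof (cases "vtype w = 0")
        case True
        have "\<mu> * mink Z w \<ge> - (\<mu> * \<bar>mink Z w\<bar>)"
          using \<mu> abs_ge_minus_self[of "\<mu> * mink Z w"] by (simp add: abs_mult)
        then show ?thesis using \<mu>w True by simp
      next
        case False
        then show ?thesis using Z tw by simp
      qed
      ultimately show ?thesis by (simp add: mink_linear)
    qed
    ultimately show ?thesis by (rule PI[OF X])
  qed
qed

lemma P_meet_spacelike:
  assumes v: "v \<in> gen_points" and w: "w \<in> gen_points" and tv: "vtype v = -1" and tw: "vtype w = -1"
    and g: "mink v w > -1"
  shows "P v \<inter> P w \<noteq> {}"
proof -
  have vv: "mink v v = 1" and ww: "mink w w = 1" and v4: "v $ 4 > 0" and w4: "w $ 4 > 0"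
    using v w tv tw by (auto simp: mem_gen_points_iff mink_self)
  define M where "M = max (v $ 4) (w $ 4)"
  define M' where "M' = min (v $ 4) (w $ 4)"
  \<comment> \<open>The least weight for which
    \<open>mink ?Y v = \<nu> * (1 + mink v w) - v $ 4\<close> and its analogue for \<open>w\<close>
    are both nonnegative.\<close>
  define \<nu> where "\<nu> = M / (1 + mink v w)"
  have M: "M > 0" "M' > 0" "v $ 4 + w $ 4 = M + M'" "v $ 4 \<le> M" "w $ 4 \<le> M"
    using v4 w4 by (auto simp: M_def M'_def)
  have \<nu>: "\<nu> > 0" "\<nu> * (1 + mink v w) = M" using g M by (auto simp: \<nu>_def)
  let ?Y = "axis 4 1 + \<nu> *\<^sub>R (v + w)"
  have "mink ?Y ?Y = -1 - 2 * \<nu> * (v $ 4 + w $ 4) + 2 * \<nu> * (\<nu> * (1 + mink v w))"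
    by (simp add: mink_linear mink_axis_4 vv ww mink_commute[of w v]
        mink_commute[of v "axis 4 1"] mink_commute[of w "axis 4 1"] algebra_simps)
  also have "\<dots> = -1 - 2 * \<nu> * M'"
    unfolding \<nu>(2) M(3) by (simp add: algebra_simps)
  also have "\<dots> < 0" using \<nu> M by (smt (verit) mult_pos_pos)
  finally have YY: "mink ?Y ?Y < 0" .
  have "?Y $ 4 > 0"
    using \<nu> v4 w4 by (simp add: mink_axis_4 add_pos_pos)
  then have X: "hnormalize ?Y \<in> H3"
    using YY by (rule hnormalize_H3[rotated])
  have "mink ?Y v = M - v $ 4" "mink ?Y w = M - w $ 4"
    unfolding \<nu>(2)[symmetric]
    by (simp_all add: mink_linear mink_axis_4 vv ww mink_commute[of w v] algebra_simps)
  then have "mink (hnormalize ?Y) v \<ge> 0" "mink (hnormalize ?Y) w \<ge> 0"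
    unfolding mink_hnormalize using M YY by auto
  then have "hnormalize ?Y \<in> P v \<inter> P w"
    using X by (simp add: P_eq v w tv tw)
  then show ?thesis by auto
qed

text \<open>Two half spaces with boundary planes tangent at infinity: pushing both points towards the
  common ideal point \<open>v + w\<close> decreases their distance.\<close>

lemma tangent_half_spaces_no_minimum:
  assumes v: "v \<in> gen_points" and w: "w \<in> gen_points" and tv: "vtype v = -1" and tw: "vtype w = -1"
    and g: "mink v w = -1"
    and disj: "P v \<inter> P w = {}" and p: "p \<in> P v" and q: "q \<in> P w"
  obtains p' q' where "p' \<in> P v" "q' \<in> P w" "hdist p' q' < hdist p q"
proof -
  have vv: "mink v v = 1" and ww: "mink w w = 1" and v4: "v $ 4 > 0" and w4: "w $ 4 > 0"
    using v w tv tw by (auto simp: mem_gen_points_iff mink_self)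
  have pH: "p \<in> H3" "mink p v \<ge> 0" and qH: "q \<in> H3" "mink q w \<ge> 0"
    using p q by (auto simp: P_eq v w tv tw)
  define n where "n = v + w"
  have nn: "mink n n = 0" and nv: "mink n v = 0" and nw: "mink n w = 0"
    by (simp_all add: n_def mink_linear vv ww g mink_commute[of w v])
  have n4: "n $ 4 > 0" using v4 w4 by (simp add: n_def)
  define A B c where "A = - mink p n" and "B = - mink q n" and "c = - mink p q"
  have AB: "A > 0" "B > 0"
    using mink_future_neg[of p n] mink_future_neg[of q n] pH qH nn n4
    by (auto simp: A_def B_def H3_def)
  have "p \<noteq> q" using disj p q by auto
  then have c: "c > 1"
    using H3_mink_le[OF pH(1) qH(1)] by (auto simp: c_def)
  \<comment> \<open>This makes \<open>mink p1 q1 = - (2 * c - 1)\<close>, while the normalizing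
    factor satisfies \<open>N \<ge> 2 * c - 1\<close>; the comparison with \<open>c\<close> then
    reduces to \<open>(c - 1)\<^sup>2 > 0\<close>.\<close>
  define \<nu> where "\<nu> = (c - 1) / (A + B)"
  have \<nu>: "\<nu> > 0" "\<nu> * (A + B) = c - 1" using c AB by (auto simp: \<nu>_def)
  define p1 q1 where "p1 = p + \<nu> *\<^sub>R n" and "q1 = q + \<nu> *\<^sub>R n"
  have np: "mink n p = - A" "mink n q = - B" "mink p n = - A" "mink q n = - B"
    by (simp_all add: A_def B_def mink_commute[of n])
  have pp: "mink p1 p1 = - (1 + 2 * \<nu> * A)" and qq: "mink q1 q1 = - (1 + 2 * \<nu> * B)"
    using H3_D(1)[OF pH(1)] H3_D(1)[OF qH(1)] by (simp_all add: p1_def q1_def mink_linear nn np)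
  have pq: "mink p1 q1 = - (c + \<nu> * (A + B))"
    by (simp add: p1_def q1_def mink_linear nn np c_def algebra_simps)
  have "1 + 2 * \<nu> * A > 0" "1 + 2 * \<nu> * B > 0" using \<nu> AB by (simp_all add: add_pos_pos)
  moreover have "p1 $ 4 > 0" "q1 $ 4 > 0"
    using H3_D(2)[OF pH(1)] H3_D(2)[OF qH(1)] \<nu> n4 by (simp_all add: p1_def q1_def add_pos_pos)
  ultimately have H: "hnormalize p1 \<in> H3" "hnormalize q1 \<in> H3"
    using pp qq by (auto intro!: hnormalize_H3)
  have "mink p1 v \<ge> 0" "mink q1 w \<ge> 0"
    using pH qH by (simp_all add: p1_def q1_def mink_linear nv nw)
  moreover have neg: "mink p1 p1 < 0" "mink q1 q1 < 0"
    using pp qq \<open>1 + 2 * \<nu> * A > 0\<close> \<open>1 + 2 * \<nu> * B > 0\<close> by auto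
  ultimately have PP: "hnormalize p1 \<in> P v" "hnormalize q1 \<in> P w"
    using H by (auto simp: P_eq v w tv tw mink_hnormalize)
  define N where "N = (1 + 2 * \<nu> * A) * (1 + 2 * \<nu> * B)"
  have N: "N > 0" using \<open>1 + 2 * \<nu> * A > 0\<close> \<open>1 + 2 * \<nu> * B > 0\<close> by (simp add: N_def)
  have e: "- mink (hnormalize p1) (hnormalize q1) = (c + \<nu> * (A + B)) / sqrt N"
    unfolding hnormalize_def mink.scaleR_left mink.scaleR_right pq pp qq
    by (simp add: N_def real_sqrt_mult minus_divide_left add_ac mult_ac)
  have "(2 * c - 1)\<^sup>2 < c\<^sup>2 * (2 * c - 1)"
  proof -
    have "(c - 1)\<^sup>2 > 0" using c by simp
    then have "2 * c - 1 < c\<^sup>2" by (simp add: power2_eq_square algebra_simps)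
    then show ?thesis using c by (simp add: power2_eq_square)
  qed
  also have "\<dots> \<le> c\<^sup>2 * N"
  proof (rule mult_left_mono)
    have "N = 1 + 2 * (\<nu> * (A + B)) + 4 * \<nu> * \<nu> * A * B"
      by (simp add: N_def algebra_simps)
    moreover have "4 * \<nu> * \<nu> * A * B \<ge> 0" using \<nu> AB by simp
    ultimately show "2 * c - 1 \<le> N" using \<nu> by simp
  qed simp
  also have "c\<^sup>2 * N = (c * sqrt N)\<^sup>2" using N by (simp add: power_mult_distrib)
  finally have "2 * c - 1 < c * sqrt N"
    using c N by (meson power2_less_imp_less less_imp_le mult_nonneg_nonneg real_sqrt_ge_zero zero_less_one order.strict_trans)
  then have less: "- mink (hnormalize p1) (hnormalize q1) < c"
    unfolding e \<nu>(2) using N by (simp add: divide_less_eq)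
  have "1 \<le> - mink (hnormalize p1) (hnormalize q1)"
    using H3_mink_le(1)[OF H] by simp
  then have "hdist (hnormalize p1) (hnormalize q1) < hdist p q"
    using less unfolding hdist_def c_def[symmetric] by (intro arcosh_real_strict_mono)
  then show ?thesis using that PP by blast
qed

lemma exp_sum_solve:
  fixes g s :: real
  assumes s: "s = 1 \<or> s = 0 \<or> s = -1" and g: "g < - (1 + s) / 2"
  obtains x where "x > 0" "g = - (exp x + s * exp (- x)) / 2"
proof -
  define r where "r = sqrt (g\<^sup>2 - s)"
  have gs: "g\<^sup>2 - s \<ge> 0"
  proof -
    have "1 \<le> g\<^sup>2" if "s = 1"
      using that g power_mono[of 1 "- g" 2] by simp
    moreover have "- 1 \<le> g\<^sup>2" using zero_le_power2[of g] by linarith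
    ultimately show ?thesis using s by auto
  qed
  \<comment> \<open>The larger root of \<open>E\<^sup>2 + 2 * g * E + s = 0\<close>, the equation
    that \<open>E = exp x\<close> has to satisfy.\<close>
  define E where "E = - g + r"
  have r: "r\<^sup>2 = g\<^sup>2 - s" "r \<ge> 0" using gs by (auto simp: r_def)
  have E1: "E > 1"
  proof -
    consider "s = 1" | "s = 0" | "s = -1" using s by blast
    then show ?thesis
    proof cases
      case 1
      then show ?thesis using g r by (simp add: E_def)
    next
      case 2
      then show ?thesis using g by (simp add: E_def r_def)
    next
      case 3
      then have "r\<^sup>2 > 1\<^sup>2" using g r by simp
      then have "r > 1" using r(2) by (rule power2_less_imp_less)
      then show ?thesis using g 3 by (simp add: E_def)
    qed
  qed
  have "E * E + s = - 2 * g * E"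
    using r(1) by (simp add: E_def power2_eq_square algebra_simps)
  then have "g = - (E + s * (1 / E)) / 2" using E1 by (simp add: field_simps)
  moreover have "exp (ln E) = E" "exp (- ln E) = 1 / E" using E1 by (simp_all add: exp_minus field_simps)
  ultimately show ?thesis
    using that[of "ln E"] E1 by simp
qed

text \<open>The meeting lemmas exclude all Gram entries at or above the bound, except for
  \<open>mink v w = -1\<close> with two half spaces: these are disjoint, and it is the minimizing
  pair \<open>p, q\<close> that rules them out.\<close>

lemma disjoint_imp_edge_pair:
  assumes v: "v \<in> gen_points" and w: "w \<in> gen_points" and disj: "P v \<inter> P w = {}"
    and pq: "p \<in> P v" "q \<in> P w" "hdist p q = hsetdist (P v) (P w)"
  obtains x where "edge_pair v w x"
proof -
  have nn: "hdist a b \<ge> 0" if "a \<in> P v" "b \<in> P w" for a b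
    using that H3_mink_le(1)[of a b] by (simp add: P_eq v w hdist_def)
  have less: "mink v w < - (1 + vtype v * vtype w) / 2"
  proof (rule ccontr)
    assume *: "\<not> ?thesis"
    consider "vtype v = 1" | "vtype w = 1" | "vtype v = 0" "vtype w = 0 \<or> vtype w = -1"
      | "vtype w = 0" "vtype v = 0 \<or> vtype v = -1" | "vtype v = -1" "vtype w = -1"
      using vtype_cases[OF v] vtype_cases[OF w] by metis
    then show False
    proof cases
      case 1
      then show False using P_meet_timelike[OF v w] * disj by simp
    next
      case 2
      then show False using P_meet_timelike[OF w v] * disj by (simp add: mink_commute Int_commute)
    next
      case 3
      then show False using P_meet_null[OF v w] * disj by simp
    next
      case 4
      then show False using P_meet_null[OF w v] * disj by (simp add: mink_commute Int_commute)
    next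
      case 5
      show False
      proof (cases "mink v w = -1")
        case True
        obtain p' q' where p': "p' \<in> P v" "q' \<in> P w" "hdist p' q' < hdist p q"
          using tangent_half_spaces_no_minimum[OF v w 5 True disj pq(1,2)] .
        have "hsetdist (P v) (P w) \<le> hdist p' q'"
          unfolding hsetdist_def using p' nn by (intro cInf_lower bdd_belowI[of _ 0]) auto
        then show False using p' pq by simp
      next
        case False
        then show False using P_meet_spacelike[OF v w 5] * disj 5 by simp
      qed
    qed
  qed
  have "vtype v * vtype w = 1 \<or> vtype v * vtype w = 0 \<or> vtype v * vtype w = -1"
    using vtype_cases[OF v] vtype_cases[OF w] by auto
  then obtain x where "x > 0" "mink v w = - (exp x + vtype v * vtype w * exp (- x)) / 2"
    using exp_sum_solve less by metis
  then have "edge_pair v w x" using v w by unfold_locales auto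
  then show ?thesis by (rule that)
qed

section \<open>Dual bases\<close>

text \<open>Converts the Minkowski product into the Euclidean one, so that duality of bases becomes
  inversion of matrices.\<close>

definition sflip :: "real^4 \<Rightarrow> real^4" where
  "sflip X = (\<chi> k. if k = 4 then - X $ 4 else X $ k)"

lemma inner_sflip: "sflip X \<bullet> Y = mink X Y"
  by (simp add: sflip_def inner_vec_def sum_4 mink_def)

lemma matrix_sflip_mult: "((\<chi> i. sflip (v i)) ** (\<chi> k j. d j $ k)) $ i $ j = mink (v i) (d j)"
  by (simp add: matrix_matrix_mult_def inner_sflip[symmetric] inner_vec_def)

lemma dual_basis_expand:
  fixes v d :: "4 \<Rightarrow> real^4"
  assumes dual: "\<And>i j. mink (v i) (d j) = (if i = j then 1 else 0)"
  shows "X = (\<Sum>i\<in>UNIV. mink X (d i) *\<^sub>R v i)"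
proof -
  define A B where "A = (\<chi> i. sflip (d i))" and "B = (\<chi> k j. v j $ k)"
  have "mink (d i) (v j) = (if i = j then 1 else 0)" for i j
    using dual[of j i] by (simp add: mink_commute[of "d i"])
  then have "A ** B = mat 1"
    unfolding A_def B_def by (simp add: vec_eq_iff matrix_sflip_mult mat_def)
  then have "B ** A = mat 1" by (rule matrix_left_right_inverse[THEN iffD1])
  then have "X = B *v (A *v X)"
    by (simp add: matrix_vector_mul_assoc)
  also have "A *v X = (\<chi> i. mink X (d i))"
    by (simp add: vec_eq_iff A_def matrix_vector_mul_component inner_sflip mink_commute[of X])
  also have "B *v \<dots> = (\<Sum>i\<in>UNIV. mink X (d i) *\<^sub>R v i)"
    by (simp add: vec_eq_iff B_def matrix_vector_mult_def mult.commute)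
  finally show ?thesis .
qed

lemma dual_basis_exists:
  fixes v :: "4 \<Rightarrow> real^4"
  assumes "\<And>n. (\<And>i. mink n (v i) = 0) \<Longrightarrow> n = 0"
  obtains d where "\<And>i j. mink (v i) (d j) = (if i = j then 1 else 0)"
proof -
  define A where "A = (\<chi> i. sflip (v i))"
  have "n = 0" if "A *v n = 0" for n
  proof (rule assms)
    fix i
    show "mink n (v i) = 0"
      using that by (simp add: A_def vec_eq_iff matrix_vector_mul_component inner_sflip mink_commute[of n])
  qed
  then obtain B where "B ** A = mat 1"
    using matrix_left_invertible_ker[of A] by blast
  then have AB: "A ** B = mat 1" by (rule matrix_left_right_inverse[THEN iffD1])
  define d where "d j = (\<chi> k. B $ k $ j)" for j
  have "mink (v i) (d j) = (if i = j then 1 else 0)" for i j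
  proof -
    have "mink (v i) (d j) = (A ** B) $ i $ j"
      unfolding A_def matrix_sflip_mult[symmetric] by (simp add: d_def matrix_matrix_mult_def)
    then show ?thesis by (simp add: AB mat_def)
  qed
  then show ?thesis by (rule that)
qed

section \<open>Volume\<close>

lemma H3_lift_component: "H3_lift x $ 4 = sqrt (1 + x \<bullet> x)" "spat (H3_lift x) = x"
  by (simp_all add: H3_lift_def spat_def vector_def vec_eq_iff forall_3)

lemma H3_lift_H3: "H3_lift x \<in> H3"
  by (simp add: H3_def mink_spat H3_lift_component add_pos_nonneg)

lemma H3_lift_spat:
  assumes "X \<in> H3"
  shows "H3_lift (spat X) = X"
proof -
  have "1 + spat X \<bullet> spat X = (X $ 4)\<^sup>2" and "X $ 4 > 0"
    using assms by (simp_all add: H3_def mink_spat power2_eq_square)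
  then show ?thesis
    by (simp add: H3_lift_def vec_eq_iff forall_4 vector_def spat_def)
qed

lemma continuous_H3_lift: "continuous_on UNIV H3_lift"
proof -
  have "continuous_on UNIV (\<lambda>x. H3_lift x $ k)" for k
  proof -
    consider "k = 1" | "k = 2" | "k = 3" | "k = 4" using exhaust_4 by blast
    then show ?thesis
      by cases (simp_all add: H3_lift_def vector_def continuous_intros)
  qed
  then have "continuous_on UNIV (\<lambda>x. \<chi> k. H3_lift x $ k)"
    by (rule continuous_on_vec_lambda)
  then show ?thesis by simp
qed

text \<open>For \<open>n $ 4 = 0\<close> the set is a Euclidean hyperplane. Otherwise a ray from the
  origin meets it at most once: membership of \<open>x\<close> and of \<open>c *\<^sub>R x\<close>
  with \<open>c \<ge> 0\<close> forces \<open>c\<^sup>2 = 1\<close>.\<close>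

lemma negligible_hyperplane_lift:
  assumes "n \<noteq> 0"
  shows "closed {x. mink n (H3_lift x) = 0}" "negligible {x. mink n (H3_lift x) = 0}"
proof -
  let ?S = "{x. mink n (H3_lift x) = 0}"
  have eq: "mink n (H3_lift x) = spat n \<bullet> x - n $ 4 * sqrt (1 + x \<bullet> x)" for x
    by (simp add: mink_spat H3_lift_component)
  show cl: "closed ?S"
    unfolding eq by (intro closed_Collect_eq continuous_intros)
  show "negligible ?S"
  proof (cases "n $ 4 = 0")
    case True
    then have "spat n \<noteq> 0"
      using assms spat_eq_0_iff[of n] by (auto simp: vec_eq_iff forall_4)
    then show ?thesis
      using True by (simp add: eq negligible_hyperplane)
  next
    case False
    show ?thesis
    proof (rule starlike_negligible[OF cl, of 0])
      fix c :: real and x :: "real^3"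
      assume c: "0 + c *\<^sub>R x \<in> ?S" "0 \<le> c" "0 + x \<in> ?S"
      then have "n $ 4 * sqrt (1 + c\<^sup>2 * (x \<bullet> x)) = n $ 4 * (c * sqrt (1 + x \<bullet> x))"
        unfolding eq by (auto simp: power2_eq_square mult_ac)
      then have "sqrt (1 + c\<^sup>2 * (x \<bullet> x)) = c * sqrt (1 + x \<bullet> x)" using False by simp
      then have "(sqrt (1 + c\<^sup>2 * (x \<bullet> x)))\<^sup>2 = (c * sqrt (1 + x \<bullet> x))\<^sup>2" by simp
      then have "1 + c\<^sup>2 * (x \<bullet> x) = c\<^sup>2 * (1 + x \<bullet> x)"
        by (simp add: power_mult_distrib)
      then have "c\<^sup>2 = 1\<^sup>2" by (simp add: algebra_simps)
      then show "c = 1" using c(2) by (metis power2_eq_imp_eq zero_le_one)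
    qed
  qed
qed

text \<open>A vector orthogonal to all \<open>v i\<close> is orthogonal to the whole cone; if it
  were nonzero, the tetrahedron would lie in one plane and have volume 0.\<close>

lemma hvolume_pos_imp_independent:
  assumes vol: "hvolume (tetrahedron v) > 0" and n: "\<And>i. mink n (v i) = 0"
  shows "n = 0"
proof (rule ccontr)
  assume "n \<noteq> 0"
  let ?S = "{x. mink n (H3_lift x) = 0}"
  have S: "?S \<in> null_sets lborel"
    using negligible_hyperplane_lift[OF \<open>n \<noteq> 0\<close>]
    by (simp add: negligible_iff_null_sets null_sets_completion_iff)
  have "mink n X = 0" if "X \<in> tetrahedron v" for X
  proof -
    obtain a where "X = (\<Sum>i\<in>UNIV. a i *\<^sub>R v i)"
      using \<open>X \<in> tetrahedron v\<close> by (auto simp: tetrahedron_def truncated_cone_def)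
    then show ?thesis by (simp add: mink.sum_right mink_linear n)
  qed
  then have "AE x in lborel. ennreal (1 / sqrt (1 + x \<bullet> x)) * indicator (tetrahedron v) (H3_lift x) = 0"
    using AE_not_in[OF S] by (auto elim!: eventually_mono simp: indicator_def)
  then have "hvolume (tetrahedron v) = (\<integral>\<^sup>+ (x :: real^3). 0 \<partial>lborel)"
    unfolding hvolume_def by (rule nn_integral_cong_AE)
  then show False using vol by simp
qed

lemma hvolume_pos:
  assumes U: "open U" "U \<inter> H3 \<subseteq> T" "X \<in> U" "X \<in> H3"
  shows "hvolume T > 0"
proof (rule ccontr)
  assume "\<not> ?thesis"
  then have 0: "hvolume T = 0" by simp
  define W where "W = H3_lift -` U"
  have W: "open W" unfolding W_def using U(1) continuous_H3_lift by (simp add: open_vimage)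
  have "spat X \<in> W" using U by (simp add: W_def H3_lift_spat)
  have "(\<integral>\<^sup>+ x. ennreal (1 / sqrt (1 + x \<bullet> x)) * indicator W x \<partial>lborel) \<le> hvolume T"
    unfolding hvolume_def using U(2) H3_lift_H3
    by (intro nn_integral_mono mult_left_mono) (auto simp: W_def indicator_def)
  with 0 have "(\<integral>\<^sup>+ x. ennreal (1 / sqrt (1 + x \<bullet> x)) * indicator W x \<partial>lborel) = 0" by simp
  moreover have "W \<in> sets borel" using W by simp
  moreover have "(\<lambda>x::real^3. 1 / sqrt (1 + x \<bullet> x)) \<in> borel_measurable borel"
    by measurable
  ultimately have "AE x in lborel. ennreal (1 / sqrt (1 + x \<bullet> x)) * indicator W x = 0"
    by (subst (asm) nn_integral_0_iff_AE) auto
  then have "AE x in lborel. x \<notin> W"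
  proof eventually_elim
    fix x :: "real^3"
    assume *: "ennreal (1 / sqrt (1 + x \<bullet> x)) * indicator W x = 0"
    have "1 / sqrt (1 + x \<bullet> x) > 0" by (simp add: add_pos_nonneg)
    then show "x \<notin> W" using * by (auto simp: indicator_def split: if_splits)
  qed
  then have "W \<in> null_sets lborel"
    using W by (subst AE_iff_null_sets) auto
  then have "negligible W"
    using W by (simp add: negligible_iff_null_sets null_sets_completion_iff)
  then show False using open_not_negligible[OF W] \<open>spat X \<in> W\<close> by auto
qed

section \<open>Tetrahedra with a dual basis\<close>

text \<open>The dual basis \<open>d\<close> encodes linear independence of the \<open>v i\<close>
  and supplies the coordinates of the cone. These data are equivalent to \<open>v\<close> being a
  generalized tetrahedron: see \<open>gen_hyp_tetrahedron\<close> and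
  \<open>gen_hyp_tetrahedron_frame\<close>.\<close>

locale tet_frame =
  fixes v d :: "4 \<Rightarrow> real^4" and x :: "4 \<Rightarrow> 4 \<Rightarrow> real"
  assumes dual: "mink (v i) (d j) = (if i = j then 1 else 0)"
    and pair: "i \<noteq> j \<Longrightarrow> edge_pair (v i) (v j) (x i j)"
begin

lemma dual': "mink (d i) (v j) = (if i = j then 1 else 0)"
  using dual[of j i] by (simp add: mink_commute[of "d i"])

lemma expand_v: "X = (\<Sum>i\<in>UNIV. mink X (d i) *\<^sub>R v i)"
  by (rule dual_basis_expand) (rule dual)

lemma expand_d: "X = (\<Sum>i\<in>UNIV. mink X (v i) *\<^sub>R d i)"
  by (rule dual_basis_expand) (rule dual')

lemma v_gen_points: "v i \<in> gen_points"
proof -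
  obtain j :: 4 where "i \<noteq> j" using exhaust_4[of i] by (metis zero_neq_one)
  then show ?thesis using edge_pair.v[OF pair] by blast
qed

text \<open>\<open>mink X (d i)\<close> is the coefficient of \<open>X\<close> at
  \<open>v i\<close>. The cone thus becomes a system of linear conditions on \<open>X\<close>,
  accessible to continuity arguments.\<close>

lemma mem_cone_iff:
  "X \<in> truncated_cone v I \<longleftrightarrow> X \<in> H3 \<and>
     (\<forall>i\<in>I. mink X (d i) \<ge> 0 \<and> mink X (v i) \<le> - (1 + vtype (v i)) / 2) \<and> (\<forall>i. i \<notin> I \<longrightarrow> mink X (d i) = 0)"
    (is "_ \<longleftrightarrow> ?R")
proof
  assume *: "X \<in> truncated_cone v I"
  then obtain a where H: "X \<in> H3" and a: "\<forall>i\<in>I. 0 \<le> a i" "X = (\<Sum>i\<in>I. a i *\<^sub>R v i)"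
    by (auto simp: truncated_cone_def)
  have "mink X (d j) = (if j \<in> I then a j else 0)" for j
    unfolding a(2) by (simp add: mink.sum_left mink_linear dual if_distrib sum.delta cong: if_cong)
  moreover have "\<forall>i\<in>I. mink X (v i) \<le> - (1 + vtype (v i)) / 2"
    using * H by (auto simp: truncated_cone_def P_int_eq[OF v_gen_points] not_less)
  ultimately show ?R using H a(1) by auto
next
  assume R: ?R
  have "X = (\<Sum>i\<in>UNIV. mink X (d i) *\<^sub>R v i)" by (rule expand_v)
  also have "\<dots> = (\<Sum>i\<in>I. mink X (d i) *\<^sub>R v i)"
    using R by (intro sum.mono_neutral_right) auto
  finally have "X = (\<Sum>i\<in>I. mink X (d i) *\<^sub>R v i)" .
  then have "\<exists>a. (\<forall>i\<in>I. 0 \<le> a i) \<and> X = (\<Sum>i\<in>I. a i *\<^sub>R v i)"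
    by (intro exI[of _ "\<lambda>i. mink X (d i)"] conjI) (use R in auto)
  then show "X \<in> truncated_cone v I"
    using R by (auto simp: truncated_cone_def P_int_eq[OF v_gen_points] not_less)
qed

lemma edge_length_eq: "i \<noteq> j \<Longrightarrow> edge_length v i j = x i j"
  unfolding edge_length_def by (rule edge_pair.hsetdist_eq[OF pair])

lemma edge_eq:
  assumes "i \<noteq> j"
  shows "edge v i j = hsegment (edge_pair.geo (v i) (v j) (x i j) 0)
                        (edge_pair.geo (v i) (v j) (x i j) (x i j))"
  unfolding edge_def by (rule edge_pair.segments_eq[OF pair[OF assms]])

lemma edge_span:
  assumes "i \<noteq> j" "X \<in> edge v i j"
  obtains a b where "X = a *\<^sub>R v i + b *\<^sub>R v j"
  using assms edge_pair.segment_span[OF pair[OF assms(1)]] edge_eq[OF assms(1)] by metis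

lemma edge_orth_iff:
  assumes "i \<noteq> j"
  shows "(\<forall>Y\<in>edge v i j. mink Y u = 0) \<longleftrightarrow> mink (v i) u = 0 \<and> mink (v j) u = 0"
  unfolding edge_eq[OF assms] by (rule edge_pair.orth_segment_iff[OF pair[OF assms]])

lemma P_disj: "i \<noteq> j \<Longrightarrow> P (v i) \<inter> P (v j) = {}"
  by (rule edge_pair.P_disjoint[OF pair])

text \<open>An edge may run through a third set \<open>P (v k)\<close>, but it starts outside of it.\<close>

lemma edge_point:
  assumes ij: "i \<noteq> j"
  obtains X a b where "X \<in> H3" "X \<in> edge v i j" "X = a *\<^sub>R v i + b *\<^sub>R v j" "a > 0" "b > 0"
    "\<forall>k. mink X (v k) < - (1 + vtype (v k)) / 2"
proof -
  interpret edge_pair "v i" "v j" "x i j" by (rule pair[OF ij])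
  have "\<forall>\<^sub>F t in at_right 0. mink (geo t) (v k) < - (1 + vtype (v k)) / 2" for k
  proof -
    consider "k = i" | "k = j" | "k \<noteq> i" "k \<noteq> j" by blast
    then show ?thesis
    proof cases
      case 1
      have "\<forall>\<^sub>F t in at_right 0. t > (0::real)" by (rule eventually_at_right_less)
      then show ?thesis
      proof eventually_elim
        case (elim t)
        then show ?case using exp_sum_mono[OF vtype_abs(1), of t] 1 by (simp add: mink_geo_v)
      qed
    next
      case 2
      have "\<forall>\<^sub>F t in at_right 0. t < x i j"
        using x by (simp add: eventually_at_right_field) (use x in blast)
      then show ?thesis
      proof eventually_elim
        case (elim t)
        then show ?case using exp_sum_mono[OF vtype_abs(2), of "x i j - t"] 2 by (simp add: mink_geo_w)
      qed
    next
      case 3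
      have "geo 0 \<notin> P (v k)" using geo_0_P P_disj[of i k] 3 by auto
      then have "mink (geo 0) (v k) < - (1 + vtype (v k)) / 2"
        using geo_H3[of 0] x by (simp add: P_eq[OF v_gen_points])
      moreover have "((\<lambda>t. mink (geo t) (v k)) \<longlongrightarrow> mink (geo 0) (v k)) (at_right 0)"
        unfolding geo_def by (intro mink.tendsto tendsto_intros)
      ultimately show ?thesis by (rule order_tendstoD(2)[rotated])
    qed
  qed
  then have "\<forall>\<^sub>F t in at_right 0. \<forall>k. mink (geo t) (v k) < - (1 + vtype (v k)) / 2"
    by (simp add: eventually_all_finite)
  moreover have "\<forall>\<^sub>F t in at_right 0. t > 0 \<and> t < x i j"
    using x by (intro eventually_conj eventually_at_right_less) (auto simp: eventually_at_right_field)
  ultimately have "\<forall>\<^sub>F t in at_right 0. (t > 0 \<and> t < x i j) \<and> (\<forall>k. mink (geo t) (v k) < - (1 + vtype (v k)) / 2)"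
    by (rule eventually_conj[rotated])
  then obtain t where t: "t > 0" "t < x i j" "\<And>k. mink (geo t) (v k) < - (1 + vtype (v k)) / 2"
    using eventually_happens'[OF trivial_limit_at_right_real] by blast
  obtain a b where "a > 0" "b > 0" "geo t = a *\<^sub>R v i + b *\<^sub>R v j"
    using geo_coeffs_pos[OF t(1,2)] .
  moreover have "geo t \<in> H3" "geo t \<in> edge v i j"
    using geo_H3[of t] geo_in_segment[of t] t by (auto simp: edge_eq[OF ij])
  ultimately show ?thesis using that t(3) by blast
qed

section \<open>The dual Gram matrix and the dihedral angles\<close>

definition H :: "4 \<Rightarrow> 4 \<Rightarrow> real" where
  "H i j = mink (d i) (d j)"

lemma H_sym: "H i j = H j i"
  by (simp add: H_def mink_commute)

lemma gram_H: "gram v ** (\<chi> i j. H i j) = mat 1"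
proof -
  have "(\<Sum>j\<in>UNIV. mink (v i) (v j) * H j k) = (if i = k then 1 else 0)" for i k
  proof -
    have "mink (v i) (d k) = mink (v i) (\<Sum>j\<in>UNIV. mink (d k) (d j) *\<^sub>R v j)"
      using expand_v[of "d k"] by simp
    also have "\<dots> = (\<Sum>j\<in>UNIV. mink (v i) (v j) * H j k)"
      by (simp add: mink.sum_right mink_linear H_def mink_commute[of "d k"] mult.commute)
    finally show ?thesis by (simp add: dual)
  qed
  then show ?thesis
    by (simp add: vec_eq_iff matrix_matrix_mult_def gram_def mat_def)
qed

lemma timelike_orth:
  assumes "i \<noteq> j"
  obtains X where "mink X X < 0" "\<forall>k. k \<noteq> i \<longrightarrow> k \<noteq> j \<longrightarrow> mink X (d k) = 0"
proof -
  obtain X a b where X: "X \<in> H3" "X = a *\<^sub>R v i + b *\<^sub>R v j"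
    using edge_point[OF assms] by metis
  then have "mink X X < 0" by (simp add: H3_def)
  moreover have "mink X (d k) = 0" if "k \<noteq> i" "k \<noteq> j" for k
    using that unfolding X(2) by (simp add: mink_linear dual)
  ultimately show ?thesis using that by blast
qed

lemma d_indep:
  assumes "k \<noteq> l" "a *\<^sub>R d k + b *\<^sub>R d l = 0"
  shows "a = 0 \<and> b = 0"
proof -
  have "mink (a *\<^sub>R d k + b *\<^sub>R d l) (v k) = 0" "mink (a *\<^sub>R d k + b *\<^sub>R d l) (v l) = 0"
    unfolding assms by (simp_all add: mink.zero_left)
  then show ?thesis using assms(1) by (simp add: mink_linear dual')
qed

text \<open>A point of the edge \<open>ij\<close> is a combination of \<open>v i\<close> and
  \<open>v j\<close>, hence orthogonal to \<open>d k\<close> and \<open>d l\<close>. Strict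
  Cauchy-Schwarz in its orthogonal complement applies, and keeps the cosine in the angle formula
  strictly between -1 and 1.\<close>

lemma H_minor_pos:
  assumes "k \<noteq> l"
  shows "(H k l)\<^sup>2 < H k k * H l l"
proof -
  obtain i j :: 4 where ij: "i \<noteq> j" "k \<noteq> i" "k \<noteq> j" "l \<noteq> i" "l \<noteq> j"
  proof -
    have "card (UNIV - {k, l}) = 2" using assms by (simp add: card_Diff_subset)
    then obtain i j where "i \<noteq> j" "UNIV - {k, l} = {i, j}" by (meson card_2_iff)
    then show ?thesis using that[of i j] by blast
  qed
  obtain X where X: "mink X X < 0" "\<forall>k. k \<noteq> i \<longrightarrow> k \<noteq> j \<longrightarrow> mink X (d k) = 0"
    using timelike_orth[OF ij(1)] .
  show ?thesis unfolding H_def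
    by (rule mink_orth_timelike_CS_less[OF X(1)]) (use X(2) ij d_indep[OF assms] in auto)
qed

lemma H_diag_pos: "H k k > 0"
proof -
  obtain i j :: 4 where ij: "i \<noteq> j" "k \<noteq> i" "k \<noteq> j"
  proof -
    have "card (UNIV - {k}) = 3" by (simp add: card_Diff_subset)
    then obtain i j m where "i \<noteq> j" "UNIV - {k} = {i, j, m}" by (metis card_3_iff)
    then show ?thesis using that[of i j] by blast
  qed
  obtain X where X: "mink X X < 0" "\<forall>k. k \<noteq> i \<longrightarrow> k \<noteq> j \<longrightarrow> mink X (d k) = 0"
    using timelike_orth[OF ij(1)] .
  have "d k \<noteq> 0" using dual[of k k] by (auto simp: mink.zero_right)
  then show ?thesis
    unfolding H_def using mink_orth_timelike_pos[OF X(1)] X(2) ij by blast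
qed

text \<open>The unit normal of the edge \<open>ij\<close> in the face \<open>ijk\<close>, where \<open>{i, j, k, l} = UNIV\<close>.\<close>

definition normal :: "4 \<Rightarrow> 4 \<Rightarrow> real^4" where
  "normal k l = (1 / sqrt (H l l * (H k k * H l l - (H k l)\<^sup>2))) *\<^sub>R (H l l *\<^sub>R d k - H k l *\<^sub>R d l)"

lemma sqrt_normalize: "N > 0 \<Longrightarrow> 1 / sqrt N * (1 / sqrt N * N) = (1::real)"
  by (simp add: field_simps)

lemma mink_normal_self: "k \<noteq> l \<Longrightarrow> mink (normal k l) (normal k l) = 1"
proof -
  assume "k \<noteq> l"
  let ?D = "H k k * H l l - (H k l)\<^sup>2"
  have D: "H l l * ?D > 0" using H_minor_pos[OF \<open>k \<noteq> l\<close>] H_diag_pos by simp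
  have "mink (H l l *\<^sub>R d k - H k l *\<^sub>R d l) (H l l *\<^sub>R d k - H k l *\<^sub>R d l) = H l l * ?D"
    by (simp add: mink_linear H_def[symmetric] H_sym[of l k] algebra_simps power2_eq_square)
  then show ?thesis
    unfolding normal_def mink.scaleR_left mink.scaleR_right using sqrt_normalize[OF D] by simp
qed

lemma mink_normal_normal:
  assumes "k \<noteq> l"
  shows "mink (normal k l) (normal l k) = - H k l / sqrt (H k k * H l l)"
proof -
  let ?D = "H k k * H l l - (H k l)\<^sup>2"
  have D: "?D > 0" using H_minor_pos[OF assms] by simp
  have "mink (H l l *\<^sub>R d k - H k l *\<^sub>R d l) (H k k *\<^sub>R d l - H k l *\<^sub>R d k) = - H k l * ?D"
    by (simp add: mink_linear H_def[symmetric] H_sym[of l k] algebra_simps power2_eq_square)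
  moreover have "sqrt (H k k * ?D) * sqrt (H l l * ?D) = sqrt (H k k * H l l) * ?D"
    using D by (simp add: real_sqrt_mult)
  ultimately have "mink (normal k l) (normal l k) = - H k l * ?D / (sqrt (H k k * H l l) * ?D)"
    unfolding normal_def mink.scaleR_left mink.scaleR_right H_sym[of l k]
      mult.commute[of "H l l" "H k k"] by simp
  then show ?thesis using D by simp
qed

text \<open>Orthogonality to the edge puts \<open>u\<close> into the span of
  \<open>d k, d l\<close>; the plane of the face forces \<open>mink u (d l) = 0\<close>, and the
  side of the face together with unit length fixes the scalar. \<open>X\<close> is arbitrary on the
  edge because \<open>dihedral_angle\<close> admits every such point.\<close>

lemma inward_normal_unique:
  assumes dist: "distinct [i, j, k, l]" and U: "UNIV = {i, j, k, l}"
    and X: "X \<in> edge v i j" and u: "inward_normal (edge v i j) (tet_face v i j k) X u"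
  shows "u = normal k l"
proof -
  have ij: "i \<noteq> j" and kl: "k \<noteq> l" using dist by auto
  obtain a b where "X = a *\<^sub>R v i + b *\<^sub>R v j" using edge_span[OF ij X] .
  then have Xd: "mink X (d k) = 0" "mink X (d l) = 0"
    using dist by (auto simp: mink_linear dual)
  have uu: "mink u u = 1" and vu: "mink (v i) u = 0" "mink (v j) u = 0"
    using u edge_orth_iff[OF ij, of u] unfolding inward_normal_def by blast+
  have uE: "mink u (v i) = 0" "mink u (v j) = 0"
    using vu by (simp_all only: mink_commute[of u])
  obtain \<delta> where \<delta>: "\<delta> > 0" "\<And>t. 0 < t \<Longrightarrow> t < \<delta> \<Longrightarrow> cosh t *\<^sub>R X + sinh t *\<^sub>R u \<in> tet_face v i j k"
    using u by (auto simp: inward_normal_def)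
  have "cosh (\<delta>/2) *\<^sub>R X + sinh (\<delta>/2) *\<^sub>R u \<in> tet_face v i j k"
    using \<delta> by simp
  then have "mink (cosh (\<delta>/2) *\<^sub>R X + sinh (\<delta>/2) *\<^sub>R u) (d k) \<ge> 0"
    "mink (cosh (\<delta>/2) *\<^sub>R X + sinh (\<delta>/2) *\<^sub>R u) (d l) = 0"
    using dist by (auto simp: tet_face_def mem_cone_iff)
  moreover have "sinh (\<delta>/2) > 0" using \<delta> by simp
  ultimately have ud: "mink u (d k) \<ge> 0" "mink u (d l) = 0"
    by (auto simp: mink_linear Xd zero_le_mult_iff)
  define A B where "A = mink u (v k)" and "B = mink u (v l)"
  have "u = (\<Sum>m\<in>{i, j, k, l}. mink u (v m) *\<^sub>R d m)"
    using expand_d[of u] U by simp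
  also have "\<dots> = A *\<^sub>R d k + B *\<^sub>R d l"
    using dist by (simp add: uE A_def B_def)
  finally have uAB: "u = A *\<^sub>R d k + B *\<^sub>R d l" .
  have "A * H k l + B * H l l = 0"
    using ud(2) unfolding uAB by (simp add: mink_linear H_def)
  then have B: "B = - A * H k l / H l l"
    using H_diag_pos[of l] by (simp add: field_simps add_eq_0_iff)
  define s where "s = A / H l l"
  let ?D = "H k k * H l l - (H k l)\<^sup>2"
  have D: "?D > 0" using H_minor_pos[OF kl] by simp
  have us: "u = s *\<^sub>R (H l l *\<^sub>R d k - H k l *\<^sub>R d l)"
    unfolding uAB B s_def using H_diag_pos[of l] by (simp add: scaleR_diff_right)
  have "mink u (d k) = s * ?D"
    unfolding us by (simp add: mink_linear H_def[symmetric] H_sym[of l k] algebra_simps power2_eq_square)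
  then have s0: "s \<ge> 0" using ud D by (simp add: zero_le_mult_iff)
  have "1 = s * s * (H l l * ?D)"
    using uu unfolding us
    by (simp add: mink_linear H_def[symmetric] H_sym[of l k] algebra_simps power2_eq_square)
  then have "sqrt (H l l * ?D) * s = 1"
    using s0 by (metis mult.commute power2_eq_square real_sqrt_abs2 real_sqrt_mult real_sqrt_one abs_of_nonneg)
  then have "s = 1 / sqrt (H l l * ?D)"
    by (metis mult_zero_left nonzero_eq_divide_eq zero_neq_one mult.commute)
  then show ?thesis unfolding us normal_def by simp
qed

text \<open>Leaving \<open>X\<close> in the direction \<open>normal k l\<close> preserves the strict
  inequalities for a short time, keeps the product with \<open>d l\<close> at 0 and makes the
  product with \<open>d k\<close> positive. The strict bounds in \<open>out\<close> come from
  \<open>edge_point\<close>.\<close>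

lemma inward_normal_exists:
  assumes dist: "distinct [i, j, k, l]" and U: "UNIV = {i, j, k, l}"
    and X: "X \<in> H3" "X = a *\<^sub>R v i + b *\<^sub>R v j" "a > 0" "b > 0"
    and out: "\<And>k. mink X (v k) < - (1 + vtype (v k)) / 2"
  shows "inward_normal (edge v i j) (tet_face v i j k) X (normal k l)"
proof -
  let ?u = "normal k l"
  have ij: "i \<noteq> j" and kl: "k \<noteq> l" using dist by auto
  let ?D = "H k k * H l l - (H k l)\<^sup>2"
  have D: "?D > 0" using H_minor_pos[OF kl] by simp
  have uv: "mink (v i) ?u = 0" "mink (v j) ?u = 0"
    using dist by (auto simp: normal_def mink_linear dual)
  have Xu: "mink X ?u = 0" unfolding X(2) by (simp add: mink_linear uv)
  have uX: "mink ?u X = 0" using Xu by (simp add: mink_commute)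
  have uu: "mink ?u ?u = 1" by (rule mink_normal_self[OF kl])
  have XX: "mink X X = -1" using X by (simp add: H3_def)
  define c where "c = 1 / sqrt (H l l * ?D)"
  have c: "c > 0" using D H_diag_pos[of l] by (simp add: c_def)
  have "mink ?u (d k) = c * ?D" "mink ?u (d l) = 0"
    unfolding normal_def c_def[symmetric]
    by (simp_all add: mink_linear H_def[symmetric] H_sym[of l k] algebra_simps power2_eq_square)
  then have ud: "mink ?u (d k) > 0" "mink ?u (d l) = 0" using c D by simp_all
  have Xd: "mink X (d i) = a" "mink X (d j) = b" "mink X (d k) = 0" "mink X (d l) = 0"
    using dist unfolding X(2) by (auto simp: mink_linear dual)
  let ?Y = "\<lambda>t. cosh t *\<^sub>R X + sinh t *\<^sub>R ?u"
  have lim: "((\<lambda>t. mink (?Y t) w) \<longlongrightarrow> mink X w) (at_right 0)" for w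
  proof -
    have "isCont (\<lambda>t. mink (?Y t) w) 0"
      by (intro continuous_intros mink.isCont) 
    then have "((\<lambda>t. mink (?Y t) w) \<longlongrightarrow> mink (?Y 0) w) (at 0)" by (simp add: isCont_def)
    then show ?thesis by (auto intro: filterlim_at_split[THEN iffD1, THEN conjunct2])
  qed
  have lim4: "((\<lambda>t. ?Y t $ 4) \<longlongrightarrow> X $ 4) (at_right 0)"
  proof -
    have "isCont (\<lambda>t. ?Y t $ 4) 0" by (intro continuous_intros)
    then have "((\<lambda>t. ?Y t $ 4) \<longlongrightarrow> ?Y 0 $ 4) (at 0)" by (simp add: isCont_def)
    then show ?thesis by (auto intro: filterlim_at_split[THEN iffD1, THEN conjunct2])
  qed
  have "\<forall>\<^sub>F t in at_right 0. mink (?Y t) (v m) < - (1 + vtype (v m)) / 2" for m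
    by (rule order_tendstoD(2)[OF lim out])
  then have e1: "\<forall>\<^sub>F t in at_right 0. \<forall>m. mink (?Y t) (v m) < - (1 + vtype (v m)) / 2"
    by (simp add: eventually_all_finite)
  have e2: "\<forall>\<^sub>F t in at_right 0. mink (?Y t) (d i) > 0"
    by (rule order_tendstoD(1)[OF lim]) (use X Xd in simp)
  have e3: "\<forall>\<^sub>F t in at_right 0. mink (?Y t) (d j) > 0"
    by (rule order_tendstoD(1)[OF lim]) (use X Xd in simp)
  have e4: "\<forall>\<^sub>F t in at_right 0. ?Y t $ 4 > 0"
    by (rule order_tendstoD(1)[OF lim4]) (rule H3_D(2)[OF X(1)])
  have "\<forall>\<^sub>F t in at_right 0. t > (0::real)" by (rule eventually_at_right_less)
  then have "\<forall>\<^sub>F t in at_right 0. ?Y t \<in> tet_face v i j k"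
    using e1 e2 e3 e4
  proof eventually_elim
    case (elim t)
    have "mink (?Y t) (?Y t) = - ((cosh t)\<^sup>2) + (sinh t)\<^sup>2"
      by (simp add: mink_linear XX Xu uX uu power2_eq_square)
    then have "mink (?Y t) (?Y t) = -1" by (simp add: cosh_square_eq)
    then have "?Y t \<in> H3" using elim by (simp add: H3_def)
    moreover have "mink (?Y t) (d k) \<ge> 0" "mink (?Y t) (d l) = 0"
      using ud elim(1) by (simp_all add: mink_linear Xd)
    moreover have "m \<in> {i, j, k} \<or> m = l" for m using U by auto
    ultimately show ?case
      using elim unfolding tet_face_def mem_cone_iff by (auto intro: less_imp_le)
  qed
  then obtain \<delta> where "\<delta> > 0" "\<forall>t. 0 < t \<and> t < \<delta> \<longrightarrow> ?Y t \<in> tet_face v i j k"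
    unfolding eventually_at_right_field by (metis)
  then show ?thesis
    unfolding inward_normal_def edge_orth_iff[OF ij] using Xu uu uv by blast
qed

lemma dihedral_angle_eq:
  assumes dist: "distinct [i, j, k, l]"
  shows "dihedral_angle v i j = arccos (- H k l / sqrt (H k k * H l l))"
  unfolding dihedral_angle_def
proof (rule the_equality)
  have "card {i, j, k, l} = card (UNIV :: 4 set)" using dist by simp
  then have U: "UNIV = {i, j, k, l}"
    by (metis card_subset_eq finite subset_UNIV)
  have U': "UNIV = {i, j, l, k}" unfolding U by auto
  have dist': "distinct [i, j, l, k]" and kl: "k \<noteq> l" and ij: "i \<noteq> j" using dist by auto
  obtain X a b where X: "X \<in> H3" "X = a *\<^sub>R v i + b *\<^sub>R v j" "a > 0" "b > 0" "X \<in> edge v i j"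
    "\<forall>k. mink X (v k) < - (1 + vtype (v k)) / 2"
    using edge_point[OF ij] by metis
  show "\<exists>k' l' X u u'. {i, j, k', l'} = UNIV \<and> X \<in> edge v i j \<and>
        inward_normal (edge v i j) (tet_face v i j k') X u \<and>
        inward_normal (edge v i j) (tet_face v i j l') X u' \<and>
        arccos (- H k l / sqrt (H k k * H l l)) = arccos (mink u u')"
    using inward_normal_exists[OF dist U X(1-4) X(6)[rule_format]] inward_normal_exists[OF dist' U' X(1-4) X(6)[rule_format]]
      U X(5) mink_normal_normal[OF kl] by metis
  fix \<theta>
  assume "\<exists>k' l' X u u'. {i, j, k', l'} = UNIV \<and> X \<in> edge v i j \<and>
        inward_normal (edge v i j) (tet_face v i j k') X u \<and>
        inward_normal (edge v i j) (tet_face v i j l') X u' \<and>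
        \<theta> = arccos (mink u u')"
  then obtain k' l' Y u u' where *: "{i, j, k', l'} = UNIV" "Y \<in> edge v i j"
        "inward_normal (edge v i j) (tet_face v i j k') Y u"
        "inward_normal (edge v i j) (tet_face v i j l') Y u'"
        "\<theta> = arccos (mink u u')" by blast
  have "k \<in> {i, j, k', l'}" "l \<in> {i, j, k', l'}" using *(1) by auto
  \<comment> \<open>The description leaves the order of the two faces open; symmetry of
    \<open>mink\<close> makes both orders agree.\<close>
  then consider "k' = k" "l' = l" | "k' = l" "l' = k" using dist by auto
  then show "\<theta> = arccos (- H k l / sqrt (H k k * H l l))"
  proof cases
    case 1
    then have "u = normal k l" "u' = normal l k"
      using inward_normal_unique[OF dist U *(2)] inward_normal_unique[OF dist' U' *(2)] * by auto
    then show ?thesis using * mink_normal_normal[OF kl] by simp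
  next
    case 2
    then have "u = normal l k" "u' = normal k l"
      using inward_normal_unique[OF dist U *(2)] inward_normal_unique[OF dist' U' *(2)] * by auto
    then show ?thesis using * mink_normal_normal[OF kl] by (simp add: mink_commute)
  qed
qed

section \<open>Volume and frontier of the tetrahedron\<close>

lemma interior_point:
  obtains X where "X \<in> H3" "\<forall>i. mink X (d i) > 0" "\<forall>i. mink X (v i) < - (1 + vtype (v i)) / 2"
proof -
  have "(1::4) \<noteq> 2" by simp
  then obtain X a b where X: "X \<in> H3" "X = a *\<^sub>R v 1 + b *\<^sub>R v 2" "a > 0" "b > 0"
    and out: "\<forall>k. mink X (v k) < - (1 + vtype (v k)) / 2"
    using edge_point[of 1 2] by metis
  \<comment> \<open>On the edge the products with \<open>d 3\<close> and \<open>d 4\<close> vanish;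
    the shift makes them positive, while the other strict inequalities survive for small
    \<open>t\<close>.\<close>
  define Y where "Y t = X + t *\<^sub>R (v 3 + v 4)" for t :: real
  have lim: "((\<lambda>t. hnormalize (Y t)) \<longlongrightarrow> X) (at_right 0)"
  proof -
    have XX: "mink X X = -1" using X by (simp add: H3_def)
    have "isCont (\<lambda>t. hnormalize (Y t)) 0"
      unfolding hnormalize_def Y_def
      by (intro continuous_intros mink.isCont) (simp add: XX)
    then have "((\<lambda>t. hnormalize (Y t)) \<longlongrightarrow> hnormalize (Y 0)) (at 0)" by (simp add: isCont_def)
    moreover have "hnormalize (Y 0) = X" by (simp add: Y_def hnormalize_def XX)
    ultimately show ?thesis by (auto intro: filterlim_at_split[THEN iffD1, THEN conjunct2])
  qed
  have "\<forall>\<^sub>F t in at_right 0. mink (hnormalize (Y t)) (v m) < - (1 + vtype (v m)) / 2" for m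
    by (rule order_tendstoD(2)[OF mink.tendsto[OF lim tendsto_const]]) (rule out[rule_format])
  then have e1: "\<forall>\<^sub>F t in at_right 0. \<forall>m. mink (hnormalize (Y t)) (v m) < - (1 + vtype (v m)) / 2"
    by (simp add: eventually_all_finite)
  have "((\<lambda>t. mink (Y t) (Y t)) \<longlongrightarrow> mink X X) (at_right 0)"
  proof -
    have "isCont (\<lambda>t. mink (Y t) (Y t)) 0"
      unfolding Y_def by (intro continuous_intros mink.isCont)
    then have "((\<lambda>t. mink (Y t) (Y t)) \<longlongrightarrow> mink (Y 0) (Y 0)) (at 0)" by (simp add: isCont_def)
    then show ?thesis by (auto simp: Y_def intro: filterlim_at_split[THEN iffD1, THEN conjunct2])
  qed
  then have e2: "\<forall>\<^sub>F t in at_right 0. mink (Y t) (Y t) < 0"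
    by (rule order_tendstoD(2)) (use X in \<open>simp add: H3_def\<close>)
  have "\<forall>\<^sub>F t in at_right 0. t > (0::real)" by (rule eventually_at_right_less)
  then have "\<forall>\<^sub>F t in at_right 0. hnormalize (Y t) \<in> H3 \<and> (\<forall>m. mink (hnormalize (Y t)) (d m) > 0) \<and>
     (\<forall>m. mink (hnormalize (Y t)) (v m) < - (1 + vtype (v m)) / 2)"
    using e1 e2
  proof eventually_elim
    case (elim t)
    have "v m $ 4 > 0" for m using v_gen_points[of m] by (simp add: mem_gen_points_iff)
    then have "Y t $ 4 > 0"
      using elim(1) H3_D(2)[OF X(1)] by (simp add: Y_def add_pos_pos)
    then have "hnormalize (Y t) \<in> H3" using elim by (intro hnormalize_H3) auto
    moreover have "mink (Y t) (d m) > 0" for m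
    proof -
      have "mink (Y t) (d m) = (if m = 1 then a else if m = 2 then b else t)"
        using exhaust_4[of m] unfolding Y_def X(2) by (auto simp: mink_linear dual)
      then show ?thesis using X elim(1) by simp
    qed
    then have "mink (hnormalize (Y t)) (d m) > 0" for m
      using elim by (simp add: mink_hnormalize)
    ultimately show ?case using elim by blast
  qed
  then obtain t where "hnormalize (Y t) \<in> H3 \<and> (\<forall>m. mink (hnormalize (Y t)) (d m) > 0) \<and>
     (\<forall>m. mink (hnormalize (Y t)) (v m) < - (1 + vtype (v m)) / 2)"
    using eventually_happens'[OF trivial_limit_at_right_real] by blast
  then show ?thesis using that by blast
qed

definition tet_open :: "(real^4) set" where
  "tet_open = {X. \<forall>i. mink X (d i) > 0 \<and> mink X (v i) < - (1 + vtype (v i)) / 2}"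

lemma open_tet_open: "open tet_open"
proof -
  have "open {X. mink X (d i) > 0}" "open {X. mink X (v i) < - (1 + vtype (v i)) / 2}" for i
    by (intro open_Collect_less continuous_intros mink.continuous_on)+
  then have "open (\<Inter>i\<in>UNIV. {X. mink X (d i) > 0} \<inter> {X. mink X (v i) < - (1 + vtype (v i)) / 2})"
    by (intro open_INT open_Int) auto
  also have "(\<Inter>i\<in>UNIV. {X. mink X (d i) > 0} \<inter> {X. mink X (v i) < - (1 + vtype (v i)) / 2}) = tet_open"
    by (auto simp: tet_open_def)
  finally show ?thesis .
qed

lemma tet_open_subset: "tet_open \<inter> H3 \<subseteq> tetrahedron v"
  by (auto simp: tet_open_def tetrahedron_def mem_cone_iff less_imp_le)

lemma hvolume_tetrahedron_pos: "hvolume (tetrahedron v) > 0"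
proof -
  obtain X where "X \<in> H3" "\<forall>i. mink X (d i) > 0" "\<forall>i. mink X (v i) < - (1 + vtype (v i)) / 2"
    using interior_point .
  then have "X \<in> H3" "X \<in> tet_open" by (auto simp: tet_open_def)
  then show ?thesis using hvolume_pos[OF open_tet_open tet_open_subset] by blast
qed

lemma closedin_tetrahedron: "closedin (top_of_set H3) (tetrahedron v)"
proof -
  have "closed {X. mink X (d i) \<ge> 0}" "closed {X. mink X (v i) \<le> - (1 + vtype (v i)) / 2}" for i
    by (intro closed_Collect_le continuous_intros mink.continuous_on)+
  then have "closed (\<Inter>i. {X. mink X (d i) \<ge> 0} \<inter> {X. mink X (v i) \<le> - (1 + vtype (v i)) / 2})"
    by (intro closed_INT ballI closed_Int)
  moreover have "tetrahedron v
      = H3 \<inter> (\<Inter>i. {X. mink X (d i) \<ge> 0} \<inter> {X. mink X (v i) \<le> - (1 + vtype (v i)) / 2})"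
    by (auto simp: tetrahedron_def mem_cone_iff)
  ultimately show ?thesis by (auto simp: closedin_closed)
qed

lemma frontier_subset:
  "(top_of_set H3) frontier_of (tetrahedron v)
     \<subseteq> \<Union> {tet_face v i j k | i j k. i \<noteq> j \<and> j \<noteq> k \<and> i \<noteq> k} \<union>
       \<Union> {tet_link v i | i. v i \<in> Cplus \<union> Splus}"
proof
  fix X assume *: "X \<in> (top_of_set H3) frontier_of (tetrahedron v)"
  have T: "X \<in> tetrahedron v"
    using * frontier_of_subset_closedin[OF closedin_tetrahedron] by blast
  then have X: "X \<in> H3" "\<And>i. mink X (d i) \<ge> 0" "\<And>i. mink X (v i) \<le> - (1 + vtype (v i)) / 2"
    by (auto simp: tetrahedron_def mem_cone_iff)
  have face: "X \<in> \<Union> {tet_face v i j k | i j k. i \<noteq> j \<and> j \<noteq> k \<and> i \<noteq> k}" if "mink X (d m) = 0" for m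
  proof -
    obtain i j k :: 4 where ijk: "UNIV - {m} = {i, j, k}" "i \<noteq> j" "j \<noteq> k" "i \<noteq> k"
    proof -
      have "card (UNIV - {m}) = 3" by (simp add: card_Diff_subset)
      then show ?thesis using that by (metis card_3_iff)
    qed
    have "X \<in> tet_face v i j k"
      unfolding tet_face_def ijk(1)[symmetric] mem_cone_iff using X that by auto
    then show ?thesis using ijk by blast
  qed
  have "X \<notin> tet_open"
  proof
    assume "X \<in> tet_open"
    have "openin (top_of_set H3) (tet_open \<inter> H3)"
      using open_tet_open by (auto simp: openin_open)
    then have "X \<in> (top_of_set H3) interior_of (tetrahedron v)"
      using \<open>X \<in> tet_open\<close> X(1) tet_open_subset by (auto simp: interior_of_def)
    then show False using * by (simp add: frontier_of_def)
  qed
  then obtain m where m: "mink X (d m) \<le> 0 \<or> mink X (v m) \<ge> - (1 + vtype (v m)) / 2"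
    by (auto simp: tet_open_def not_less)
  show "X \<in> \<Union> {tet_face v i j k | i j k. i \<noteq> j \<and> j \<noteq> k \<and> i \<noteq> k} \<union>
       \<Union> {tet_link v i | i. v i \<in> Cplus \<union> Splus}"
  proof (cases "mink X (d m) \<le> 0")
    case True
    then show ?thesis using face[of m] X(2)[of m] by auto
  next
    case False
    then have e: "mink X (v m) = - (1 + vtype (v m)) / 2"
      using m X(3)[of m] by auto
    show ?thesis
    proof (cases "v m \<in> H3")
      \<comment> \<open>A vertex in \<open>H3\<close> has no link, but equality then means
        \<open>X = v m\<close>, which lies on the face opposite to any other vertex
        \<open>v j\<close>.\<close>
      case True
      then have "X = v m"
        using e H3_mink_le(2)[OF X(1) True] by (simp add: H3_vtype)
      moreover obtain j :: 4 where "m \<noteq> j" using exhaust_4[of m] by (metis zero_neq_one)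
      ultimately show ?thesis using face[of j] by (simp add: dual)
    next
      case False
      then have "v m \<in> Cplus \<union> Splus" using v_gen_points[of m] by (auto simp: gen_points_def)
      then have "tet_link v m \<in> {tet_link v i | i. v i \<in> Cplus \<union> Splus}" by blast
      moreover have "X \<in> tet_link v m"
        using T X(1) e by (simp add: tet_link_def P_eq[OF v_gen_points] P_int_eq[OF v_gen_points])
      ultimately show ?thesis by (intro UnI2) (rule UnionI)
    qed
  qed
qed

lemma gen_hyp_tetrahedron: "gen_hyp_tetrahedron v"
  unfolding gen_hyp_tetrahedron_def
proof (intro conjI allI impI)
  show "v i \<in> H3 \<union> Cplus \<union> Splus" for i using v_gen_points by (simp add: gen_points_def)
  show "P (v i) \<inter> P (v j) = {}" if "i \<noteq> j" for i j using P_disj[OF that] .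
  show "edge v i j \<noteq> {}" if "i \<noteq> j" for i j by (rule edge_point[OF that]) auto
qed (fact frontier_subset hvolume_tetrahedron_pos)+

end

lemma gen_hyp_tetrahedron_frame:
  assumes "gen_hyp_tetrahedron v"
  obtains d where "tet_frame v d (edge_length v)"
proof -
  have gen_points: "v i \<in> gen_points" for i using assms by (auto simp: gen_hyp_tetrahedron_def gen_points_def)
  have vol: "hvolume (tetrahedron v) > 0" using assms by (simp add: gen_hyp_tetrahedron_def)
  obtain d where d: "\<And>i j. mink (v i) (d j) = (if i = j then 1 else 0)"
    using dual_basis_exists hvolume_pos_imp_independent[OF vol] by blast
  have "edge_pair (v i) (v j) (edge_length v i j)" if "i \<noteq> j" for i j
  proof -
    have disj: "P (v i) \<inter> P (v j) = {}" and "edge v i j \<noteq> {}"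
      using assms that by (auto simp: gen_hyp_tetrahedron_def)
    then obtain p q where "p \<in> P (v i)" "q \<in> P (v j)" "hdist p q = hsetdist (P (v i)) (P (v j))"
      by (auto simp: edge_def)
    then obtain y where y: "edge_pair (v i) (v j) y"
      using disjoint_imp_edge_pair[OF gen_points gen_points disj] by metis
    then show ?thesis
      using edge_pair.hsetdist_eq[OF y] by (simp add: edge_length_def)
  qed
  then have "tet_frame v d (edge_length v)" using d by (intro tet_frame.intro)
  then show ?thesis by (rule that)
qed

section \<open>Determinants and inverse matrices\<close>

lemma det_4:
  "det (A::'a::comm_ring_1^4^4) =
      A$1$1 * (A$2$2 * (A$3$3 * A$4$4 - A$3$4 * A$4$3) - A$2$3 * (A$3$2 * A$4$4 - A$3$4 * A$4$2)
             + A$2$4 * (A$3$2 * A$4$3 - A$3$3 * A$4$2))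
    - A$1$2 * (A$2$1 * (A$3$3 * A$4$4 - A$3$4 * A$4$3) - A$2$3 * (A$3$1 * A$4$4 - A$3$4 * A$4$1)
             + A$2$4 * (A$3$1 * A$4$3 - A$3$3 * A$4$1))
    + A$1$3 * (A$2$1 * (A$3$2 * A$4$4 - A$3$4 * A$4$2) - A$2$2 * (A$3$1 * A$4$4 - A$3$4 * A$4$1)
             + A$2$4 * (A$3$1 * A$4$2 - A$3$2 * A$4$1))
    - A$1$4 * (A$2$1 * (A$3$2 * A$4$3 - A$3$3 * A$4$2) - A$2$2 * (A$3$1 * A$4$3 - A$3$3 * A$4$1)
             + A$2$3 * (A$3$1 * A$4$2 - A$3$2 * A$4$1))"
proof -
  have f1234: "finite {2::4, 3, 4}" "1 \<notin> {2::4, 3, 4}"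
    by auto
  have f234: "finite {3::4, 4}" "2 \<notin> {3::4, 4}"
    by auto
  have f34: "finite {4::4}" "3 \<notin> {4::4}"
    by auto
  show ?thesis
    unfolding det_def UNIV_4
    unfolding sum_over_permutations_insert[OF f1234]
    unfolding sum_over_permutations_insert[OF f234]
    unfolding sum_over_permutations_insert[OF f34]
    unfolding permutes_sing
    by (simp add: sign_swap_id permutation_swap_id permutation_compose sign_compose sign_id
        swap_id_eq algebra_simps)
qed

text \<open>Multiply \<open>A\<close> by the identity matrix whose column \<open>i\<close> is
  replaced by that of \<open>B\<close>. The product is \<open>A\<close> with a unit vector in column
  \<open>i\<close>, and comparing determinants gives the cofactor.\<close>

lemma det_delete_row_col:
  fixes A B :: "real^4^4"
  assumes AB: "A ** B = mat 1"
  shows "det (delete_row_col A i) = det A * B $ i $ i"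
proof -
  define N :: "real^4^4" where "N = (\<chi> a b. if b = i then B $ a $ b else if a = b then 1 else 0)"
  have "(A ** N) $ a $ b = (if b = i then (if a = b then 1 else 0) else A $ a $ b)" for a b
  proof (cases "b = i")
    case True
    then have "(A ** N) $ a $ b = (A ** B) $ a $ b"
      by (simp add: matrix_matrix_mult_def N_def)
    then show ?thesis using True by (simp add: AB mat_def)
  next
    case False
    then have "A $ a $ c * N $ c $ b = (if c = b then A $ a $ c else 0)" for c by (simp add: N_def)
    then have "(A ** N) $ a $ b = (\<Sum>c\<in>UNIV. if c = b then A $ a $ c else 0)"
      unfolding matrix_matrix_mult_def by (simp only: vec_lambda_beta)
    then show ?thesis using False by simp
  qed
  then have AN: "A ** N = (\<chi> a b. if b = i then (if a = b then 1 else 0) else A $ a $ b)"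
    by (simp add: vec_eq_iff)
  have "det N = B $ i $ i"
    using exhaust_4[of i] by (elim disjE) (simp_all add: N_def det_4)
  moreover have "det (A ** N) = det (delete_row_col A i)"
    unfolding AN using exhaust_4[of i]
    by (elim disjE) (simp_all add: det_4 det_3 delete_row_col_def skip_def algebra_simps)
  ultimately show ?thesis by (simp add: det_mul)
qed

lemma det_two_unit_columns:
  fixes A :: "'a::comm_ring_1^4^4"
  shows "\<forall>p q r s. distinct [r, s, p, q] \<longrightarrow>
    det (\<chi> a b. if b = p \<or> b = q then (if a = b then 1 else 0) else A $ a $ b)
      = A $ r $ r * A $ s $ s - A $ r $ s * A $ s $ r"
  unfolding forall_4
  apply simp
  apply (intro conjI)
  apply (simp_all add: det_4)
  done

text \<open>The device of \<open>det_delete_row_col\<close> with two columns: \<open>A ** N\<close>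
  has unit vectors in columns \<open>p, q\<close>, so its determinant is the complementary minor of
  \<open>A\<close>.\<close>

lemma jacobi_minor_2:
  fixes A B :: "real^4^4"
  assumes AB: "A ** B = mat 1" and dist: "distinct [r, s, p, q]"
  shows "A $ r $ r * A $ s $ s - A $ r $ s * A $ s $ r
       = det A * (B $ p $ p * B $ q $ q - B $ p $ q * B $ q $ p)"
proof -
  define N :: "real^4^4" where
    "N = (\<chi> a b. if b = p \<or> b = q then B $ a $ b else if a = b then 1 else 0)"
  have "(A ** N) $ a $ b = (if b = p \<or> b = q then (if a = b then 1 else 0) else A $ a $ b)" for a b
  proof (cases "b = p \<or> b = q")
    case True
    then have "(A ** N) $ a $ b = (A ** B) $ a $ b"
      by (simp add: matrix_matrix_mult_def N_def)
    then show ?thesis using True by (simp add: AB mat_def)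
  next
    case False
    then have "A $ a $ c * N $ c $ b = (if c = b then A $ a $ c else 0)" for c by (simp add: N_def)
    then have "(A ** N) $ a $ b = (\<Sum>c\<in>UNIV. if c = b then A $ a $ c else 0)"
      unfolding matrix_matrix_mult_def by (simp only: vec_lambda_beta)
    then show ?thesis using False by simp
  qed
  then have AN: "A ** N = (\<chi> a b. if b = p \<or> b = q then (if a = b then 1 else 0) else A $ a $ b)"
    by (simp add: vec_eq_iff)
  have "det N = B $ p $ p * B $ q $ q - B $ p $ q * B $ q $ p"
    using exhaust_4[of p] exhaust_4[of q] dist
    by (elim disjE) (simp_all add: N_def det_4)
  moreover have "det (A ** N) = A $ r $ r * A $ s $ s - A $ r $ s * A $ s $ r"
    unfolding AN using det_two_unit_columns dist by blast
  ultimately show ?thesis by (simp add: det_mul)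
qed

section \<open>Inverse matrices and their derivatives\<close>

lemma matrix_inv_right:
  fixes A :: "real^'n^'n"
  assumes "det A \<noteq> 0"
  shows "A ** matrix_inv A = mat 1"
proof -
  have "\<exists>B. A ** B = mat 1 \<and> B ** A = mat 1"
    using assms by (simp add: invertible_det_nz[symmetric] invertible_def)
  then show ?thesis unfolding matrix_inv_def by (rule someI2_ex) simp
qed

lemma matrix_inv_left:
  fixes A :: "real^'n^'n"
  assumes "det A \<noteq> 0"
  shows "matrix_inv A ** A = mat 1"
  using matrix_inv_right[OF assms] by (simp add: matrix_left_right_inverse)

lemma matrix_inv_unique_right:
  fixes A B :: "real^'n^'n"
  assumes AB: "A ** B = mat 1"
  shows "matrix_inv A = B" and "det A \<noteq> 0"
proof -
  have "det A * det B = 1" using AB by (metis det_mul det_I)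
  then show "det A \<noteq> 0" by auto
  then have "matrix_inv A ** (A ** B) = B"
    by (simp add: matrix_mul_assoc matrix_inv_left)
  then show "matrix_inv A = B" by (simp add: AB)
qed

lemma has_derivative_transform_nhds:
  assumes "(f has_derivative f') (at x)" "\<forall>\<^sub>F y in nhds x. f y = g y"
  shows "(g has_derivative f') (at x)"
  using assms(2) by (intro has_derivative_transform_eventually[OF assms(1)])
    (auto simp: eventually_nhds_conv_at)

lemma differentiable_det:
  fixes A :: "'a::real_normed_vector \<Rightarrow> real^'n^'n"
  assumes "\<And>i j. (\<lambda>x. A x $ i $ j) differentiable (at x)"
  shows "(\<lambda>x. det (A x)) differentiable (at x)"
proof -
  obtain D where D: "\<And>i j. ((\<lambda>x. A x $ i $ j) has_derivative D i j) (at x)"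
    using assms unfolding differentiable_def by metis
  show ?thesis
    unfolding differentiable_def det_def
    by (rule exI) (rule has_derivative_sum has_derivative_mult_right has_derivative_prod D)+
qed

text \<open>Gives access to differentiability: \<open>matrix_inv\<close> is defined by choice, but
  at nonsingular matrices its entries are quotients of determinants.\<close>

lemma matrix_inv_cramer:
  fixes A :: "real^'n^'n"
  assumes "det A \<noteq> 0"
  shows "matrix_inv A $ k $ l = det (\<chi> i j. if j = k then (if i = l then 1 else 0) else A $ i $ j) / det A"
proof -
  have "A ** matrix_inv A = mat 1" by (rule matrix_inv_right[OF assms])
  then have "A *v (\<chi> i. matrix_inv A $ i $ l) = (\<chi> i. if i = l then 1 else 0)"
    by (simp add: vec_eq_iff matrix_vector_mult_def matrix_matrix_mult_def mat_def)
  then have "(\<chi> i. matrix_inv A $ i $ l)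
      = (\<chi> k. det (\<chi> i j. if j = k then (\<chi> i. if i = l then 1 else 0) $ i else A $ i $ j) / det A)"
    by (rule cramer[OF assms, THEN iffD1])
  then show ?thesis by (simp add: vec_eq_iff cong: if_cong)
qed

lemma eventually_det_nonzero:
  fixes A :: "'a::real_normed_vector \<Rightarrow> real^'n^'n"
  assumes A: "\<And>i j. (\<lambda>x. A x $ i $ j) differentiable (at x)" and det: "det (A x) \<noteq> 0"
  shows "\<forall>\<^sub>F y in nhds x. det (A y) \<noteq> 0"
proof -
  have "isCont (\<lambda>x. det (A x)) x"
    using differentiable_imp_continuous_within[OF differentiable_det[OF A]] by simp
  then have "filterlim (\<lambda>x. det (A x)) (nhds (det (A x))) (nhds x)"
    unfolding isCont_def by (rule tendsto_at_iff_tendsto_nhds[THEN iffD1])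
  then show ?thesis by (rule tendsto_imp_eventually_ne) (rule det)
qed

lemma differentiable_matrix_inv:
  fixes A :: "'a::real_normed_vector \<Rightarrow> real^'n^'n"
  assumes A: "\<And>i j. (\<lambda>x. A x $ i $ j) differentiable (at x)" and det: "det (A x) \<noteq> 0"
  shows "(\<lambda>x. matrix_inv (A x) $ k $ l) differentiable (at x)"
proof -
  let ?C = "\<lambda>x. det (\<chi> i j. if j = k then (if i = l then 1 else 0) else A x $ i $ j)"
  have "?C differentiable (at x)"
  proof (rule differentiable_det)
    fix i j
    show "(\<lambda>x. (\<chi> i j. if j = k then (if i = l then 1 else 0) else A x $ i $ j) $ i $ j) differentiable (at x)"
      by (cases "j = k"; cases "i = l") (simp_all add: A)
  qed
  then have "(\<lambda>x. ?C x / det (A x)) differentiable (at x)"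
    using differentiable_det[OF A] det by (intro differentiable_divide)
  then obtain D where D: "((\<lambda>x. ?C x / det (A x)) has_derivative D) (at x)"
    by (auto simp: differentiable_def)
  have "\<forall>\<^sub>F y in nhds x. det (A y) \<noteq> 0" by (rule eventually_det_nonzero[OF A det])
  then have "\<forall>\<^sub>F y in nhds x. ?C y / det (A y) = matrix_inv (A y) $ k $ l"
    by eventually_elim (simp add: matrix_inv_cramer)
  then have "((\<lambda>x. matrix_inv (A x) $ k $ l) has_derivative D) (at x)"
    by (rule has_derivative_transform_nhds[OF D])
  then show ?thesis by (auto simp: differentiable_def)
qed

text \<open>Once the derivative \<open>B'\<close> is known to exist, differentiating
  \<open>A x ** matrix_inv (A x) = mat 1\<close>, which holds near the point, yields
  \<open>A B' = - A' B\<close>; multiplying by \<open>B\<close> from the left solves for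
  \<open>B'\<close>.\<close>

lemma has_derivative_matrix_inv:
  fixes A :: "'a::real_normed_vector \<Rightarrow> real^'n^'n"
  assumes A: "\<And>i j. ((\<lambda>x. A x $ i $ j) has_derivative A' i j) (at x)" and det: "det (A x) \<noteq> 0"
  shows "((\<lambda>x. matrix_inv (A x) $ k $ l) has_derivative
    (\<lambda>h. - (\<Sum>r\<in>UNIV. \<Sum>s\<in>UNIV. matrix_inv (A x) $ k $ r * A' r s h * matrix_inv (A x) $ s $ l))) (at x)"
proof -
  have Ad: "\<And>i j. (\<lambda>x. A x $ i $ j) differentiable (at x)"
    using A by (auto simp: differentiable_def)
  obtain B' where B': "\<And>k l. ((\<lambda>x. matrix_inv (A x) $ k $ l) has_derivative B' k l) (at x)"
    using differentiable_matrix_inv[OF Ad det] unfolding differentiable_def by metis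
  define B where "B = matrix_inv (A x)"
  have BA: "B ** A x = mat 1" unfolding B_def by (rule matrix_inv_left[OF det])
  have prod: "(\<Sum>s\<in>UNIV. A x $ r $ s * B' s l h) = - (\<Sum>s\<in>UNIV. A' r s h * B $ s $ l)" for r h
  proof -
    have 1: "((\<lambda>x. \<Sum>s\<in>UNIV. A x $ r $ s * matrix_inv (A x) $ s $ l) has_derivative
        (\<lambda>h. \<Sum>s\<in>UNIV. A x $ r $ s * B' s l h + A' r s h * matrix_inv (A x) $ s $ l)) (at x)"
      by (intro has_derivative_sum has_derivative_mult A B')
    have "\<forall>\<^sub>F y in nhds x. det (A y) \<noteq> 0" by (rule eventually_det_nonzero[OF Ad det])
    then have "\<forall>\<^sub>F y in nhds x. (\<Sum>s\<in>UNIV. A y $ r $ s * matrix_inv (A y) $ s $ l) = (if r = l then 1 else 0)"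
    proof eventually_elim
      case (elim y)
      then have "A y ** matrix_inv (A y) = mat 1"
        by (simp add: matrix_inv_right)
      then have "(A y ** matrix_inv (A y)) $ r $ l = (if r = l then 1 else 0)"
        by (simp add: mat_def)
      then show ?case by (simp add: matrix_matrix_mult_def)
    qed
    then have "((\<lambda>x. if r = l then 1 else 0) has_derivative
        (\<lambda>h. \<Sum>s\<in>UNIV. A x $ r $ s * B' s l h + A' r s h * matrix_inv (A x) $ s $ l)) (at x)"
      by (rule has_derivative_transform_nhds[OF 1])
    then have "(\<lambda>h. \<Sum>s\<in>UNIV. A x $ r $ s * B' s l h + A' r s h * matrix_inv (A x) $ s $ l) = (\<lambda>h. 0)"
      by (rule has_derivative_unique) (rule has_derivative_const)
    then have "(\<Sum>s\<in>UNIV. A x $ r $ s * B' s l h + A' r s h * B $ s $ l) = 0"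
      unfolding B_def by metis
    then show ?thesis by (simp add: sum.distrib add_eq_0_iff)
  qed
  have "B' k l h = - (\<Sum>r\<in>UNIV. \<Sum>s\<in>UNIV. B $ k $ r * A' r s h * B $ s $ l)" for h
  proof -
    have "B' k l h = (\<Sum>s\<in>UNIV. (B ** A x) $ k $ s * B' s l h)"
      by (simp add: BA mat_def if_distrib if_distribR cong: if_cong)
    also have "\<dots> = (\<Sum>s\<in>UNIV. \<Sum>r\<in>UNIV. B $ k $ r * (A x $ r $ s * B' s l h))"
      by (simp add: matrix_matrix_mult_def sum_distrib_right mult.assoc)
    also have "\<dots> = (\<Sum>r\<in>UNIV. B $ k $ r * (\<Sum>s\<in>UNIV. A x $ r $ s * B' s l h))"
      by (subst sum.swap) (simp add: sum_distrib_left)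
    also have "\<dots> = - (\<Sum>r\<in>UNIV. \<Sum>s\<in>UNIV. B $ k $ r * A' r s h * B $ s $ l)"
      by (simp add: prod sum_negf sum_distrib_left mult.assoc)
    finally show ?thesis .
  qed
  then have "B' k l = (\<lambda>h. - (\<Sum>r\<in>UNIV. \<Sum>s\<in>UNIV. B $ k $ r * A' r s h * B $ s $ l))" by auto
  then show ?thesis using B'[of k l] unfolding B_def by simp
qed

section \<open>The Gram matrix and the angles as functions of the lengths\<close>

lemma exhaust_6:
  fixes x :: 6
  shows "x = 1 \<or> x = 2 \<or> x = 3 \<or> x = 4 \<or> x = 5 \<or> x = 6"
proof (induct x)
  case (of_int z)
  then have "z = 0 \<or> z = 1 \<or> z = 2 \<or> z = 3 \<or> z = 4 \<or> z = 5" by fastforce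
  \<comment> \<open>In the type \<open>6\<close> the numeral \<open>6\<close> denotes
    \<open>0\<close>.\<close>
  then show ?case by auto
qed

lemma forall_6: "(\<forall>i::6. Q i) \<longleftrightarrow> Q 1 \<and> Q 2 \<and> Q 3 \<and> Q 4 \<and> Q 5 \<and> Q 6"
  by (metis exhaust_6)

lemma UNIV_6: "UNIV = {1, 2, 3, 4, 5, 6::6}"
  using exhaust_6 by auto

lemma sum_6: "sum f (UNIV::6 set) = f 1 + f 2 + f 3 + f 4 + f 5 + f 6"
  unfolding UNIV_6 by (simp add: ac_simps)

lemma vector_6:
  "(vector [a, b, c, d, e, f] :: ('a::zero)^6) $ 1 = a"
  "(vector [a, b, c, d, e, f] :: ('a::zero)^6) $ 2 = b"
  "(vector [a, b, c, d, e, f] :: ('a::zero)^6) $ 3 = c"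
  "(vector [a, b, c, d, e, f] :: ('a::zero)^6) $ 4 = d"
  "(vector [a, b, c, d, e, f] :: ('a::zero)^6) $ 5 = e"
  "(vector [a, b, c, d, e, f] :: ('a::zero)^6) $ 6 = f"
  unfolding vector_def by simp_all

lemma sextuple_nth:
  "sextuple f $ 1 = f 1 2" "sextuple f $ 2 = f 1 3" "sextuple f $ 3 = f 1 4"
  "sextuple f $ 4 = f 2 3" "sextuple f $ 5 = f 2 4" "sextuple f $ 6 = f 3 4"
  by (simp_all add: sextuple_def vector_6)

definition pair_index :: "4 \<Rightarrow> 4 \<Rightarrow> 6" where
  "pair_index i j =
     (if i = 1 \<or> j = 1 then (if i = 2 \<or> j = 2 then 1 else if i = 3 \<or> j = 3 then 2 else 3)
      else if i = 2 \<or> j = 2 then (if i = 3 \<or> j = 3 then 4 else 5) else 6)"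

text \<open>Inverse to \<open>sextuple\<close>: a vector read as a symmetric array with zero
  diagonal, so that sums can run over all ordered pairs of indices.\<close>

definition entry :: "real^6 \<Rightarrow> 4 \<Rightarrow> 4 \<Rightarrow> real" where
  "entry h i j = (if i = j then 0 else h $ pair_index i j)"

lemma entry_sym: "entry h i j = entry h j i"
  by (auto simp: entry_def pair_index_def)

lemma entry_self [simp]: "entry h i i = 0"
  by (simp add: entry_def)

lemma bounded_linear_entry: "bounded_linear (\<lambda>h. entry h i j)"
  by (cases "i = j") (simp_all add: entry_def bounded_linear_vec_nth)

lemma sextuple_entry: "sextuple (entry h) = h"
  by (simp add: vec_eq_iff forall_6 sextuple_nth entry_def pair_index_def)

lemma entry_sextuple:
  assumes "\<And>i j. i \<noteq> j \<Longrightarrow> f i j = f j i" "i \<noteq> j"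
  shows "entry (sextuple f) i j = f i j"
proof -
  have "f 2 1 = f 1 2" "f 3 1 = f 1 3" "f 4 1 = f 1 4" "f 3 2 = f 2 3" "f 4 2 = f 2 4" "f 4 3 = f 3 4"
    by (simp_all add: assms(1))
  then show ?thesis
    using assms(2) exhaust_4[of i] exhaust_4[of j]
    by (elim disjE) (simp_all add: entry_def pair_index_def sextuple_nth)
qed

definition gram_of_lengths :: "(4 \<Rightarrow> real) \<Rightarrow> real^6 \<Rightarrow> real^4^4" where
  "gram_of_lengths \<epsilon> x = (\<chi> i j. if i = j then - \<epsilon> i
     else - (exp (entry x i j) + \<epsilon> i * \<epsilon> j * exp (- entry x i j)) / 2)"

text \<open>The angle at the edge opposite to \<open>kl\<close>, in terms of the inverse \<open>B\<close> of the Gram matrix.\<close>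

definition opposite_angle :: "real^4^4 \<Rightarrow> 4 \<Rightarrow> 4 \<Rightarrow> real" where
  "opposite_angle B k l = arccos (- B $ k $ l / sqrt (B $ k $ k * B $ l $ l))"

text \<open>Explicit total substitute for \<open>angles_of_lengths\<close>. The pairs appear in
  reverse order because the angle at an edge is computed from the opposite pair.\<close>

definition angles_fun :: "(4 \<Rightarrow> real) \<Rightarrow> real^6 \<Rightarrow> real^6" where
  "angles_fun \<epsilon> x = (let A = opposite_angle (matrix_inv (gram_of_lengths \<epsilon> x)) in
     vector [A 3 4, A 2 4, A 2 3, A 1 4, A 1 3, A 1 2])"

lemma edge_pair_sym: "edge_pair v w x \<Longrightarrow> edge_pair w v x"
  by (simp add: edge_pair_def mink_commute[of w v] mult.commute)

context tet_frame
begin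

lemma edge_length_sym: "i \<noteq> j \<Longrightarrow> edge_length v i j = edge_length v j i"
  using edge_pair.hsetdist_eq[OF edge_pair_sym[OF pair[of i j]]] edge_length_eq[of i j]
  by (simp add: edge_length_def)

lemma entry_lengths: "i \<noteq> j \<Longrightarrow> entry (lengths v) i j = x i j"
  unfolding lengths_def using entry_sextuple[of "edge_length v" i j] edge_length_sym edge_length_eq
  by simp

lemma gram_eq: "gram v = gram_of_lengths (\<lambda>i. vtype (v i)) (lengths v)"
  using edge_pair.vw[OF pair]
  by (simp add: vec_eq_iff gram_def gram_of_lengths_def mink_self entry_lengths)

lemma matrix_inv_gram: "matrix_inv (gram v) $ i $ j = H i j" and det_gram_nonzero: "det (gram v) \<noteq> 0"
  using matrix_inv_unique_right[OF gram_H] by auto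

lemma dihedral_angle_opposite:
  assumes "distinct [i, j, k, l]"
  shows "dihedral_angle v i j = opposite_angle (matrix_inv (gram v)) k l"
  by (simp add: dihedral_angle_eq[OF assms] opposite_angle_def matrix_inv_gram)

lemma angles_eq: "angles v = angles_fun (\<lambda>i. vtype (v i)) (lengths v)"
proof -
  have "dihedral_angle v 1 2 = opposite_angle (matrix_inv (gram v)) 3 4"
    "dihedral_angle v 1 3 = opposite_angle (matrix_inv (gram v)) 2 4"
    "dihedral_angle v 1 4 = opposite_angle (matrix_inv (gram v)) 2 3"
    "dihedral_angle v 2 3 = opposite_angle (matrix_inv (gram v)) 1 4"
    "dihedral_angle v 2 4 = opposite_angle (matrix_inv (gram v)) 1 3"
    "dihedral_angle v 3 4 = opposite_angle (matrix_inv (gram v)) 1 2"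
    by (rule dihedral_angle_opposite, simp)+
  then show ?thesis
    by (simp add: angles_def angles_fun_def Let_def sextuple_def gram_eq[symmetric])
qed

end

text \<open>Types and lengths fix the Gram matrix, and the angles depend on nothing else; this is
  the uniqueness that the definite description requires.\<close>

lemma angles_of_lengths_eq:
  assumes "gen_hyp_tetrahedron w" "\<forall>i. vtype (w i) = \<epsilon> i" "lengths w = x"
  shows "angles_of_lengths \<epsilon> x = angles_fun \<epsilon> x"
proof -
  have *: "angles u = angles_fun \<epsilon> x"
    if u: "gen_hyp_tetrahedron u" "\<forall>i. vtype (u i) = \<epsilon> i" "lengths u = x" for u
  proof -
    obtain d where "tet_frame u d (edge_length u)" using gen_hyp_tetrahedron_frame[OF u(1)] .
    then have "angles u = angles_fun (\<lambda>i. vtype (u i)) (lengths u)" by (rule tet_frame.angles_eq)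
    also have "(\<lambda>i. vtype (u i)) = \<epsilon>" using u(2) by auto
    finally show ?thesis using u(3) by simp
  qed
  show ?thesis
    unfolding angles_of_lengths_def
  proof (rule the_equality)
    show "\<exists>v. gen_hyp_tetrahedron v \<and> (\<forall>i. vtype (v i) = \<epsilon> i) \<and> lengths v = x \<and> angles v = angles_fun \<epsilon> x"
      using assms *[OF assms] by blast
  qed (use * in blast)
qed

lemma has_derivative_gram_of_lengths:
  "((\<lambda>x. gram_of_lengths \<epsilon> x $ i $ j) has_derivative
     (\<lambda>h. - ((exp (entry x i j) - \<epsilon> i * \<epsilon> j * exp (- entry x i j)) / 2) * entry h i j)) (at x)"
proof (cases "i = j")
  case False
  note [derivative_intros] = bounded_linear_imp_has_derivative[OF bounded_linear_entry]
  show ?thesis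
    unfolding gram_of_lengths_def
    by (auto simp: False fun_eq_iff field_simps intro!: derivative_eq_intros)
qed (simp add: gram_of_lengths_def)

lemma continuous_gram_of_lengths: "continuous_on UNIV (gram_of_lengths \<epsilon>)"
proof -
  have "continuous_on UNIV (\<lambda>x. gram_of_lengths \<epsilon> x $ i $ j)" for i j
    by (rule has_derivative_continuous_on[OF has_derivative_at_withinI[OF has_derivative_gram_of_lengths]])
  then have "continuous_on UNIV (\<lambda>x. \<chi> i j. gram_of_lengths \<epsilon> x $ i $ j)"
    by (intro continuous_on_vec_lambda)
  then show ?thesis by simp
qed

section \<open>Realizing nearby lengths\<close>

lemma has_derivative_vec:
  fixes f :: "'a::real_normed_vector \<Rightarrow> 'b::euclidean_space^'n"
  assumes "\<And>i. ((\<lambda>x. f x $ i) has_derivative (\<lambda>h. f' h $ i)) (at x)"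
  shows "(f has_derivative f') (at x)"
  unfolding has_derivative_componentwise_within[of f]
  by (auto simp: Basis_vec_def inner_axis intro: has_derivative_inner_left assms)

text \<open>The antisymmetric correction term makes the derivative of the Gram map at \<open>v\<close> onto all
  matrices instead of the symmetric ones only.\<close>

definition gram_ext :: "(4 \<Rightarrow> real^4) \<Rightarrow> real^4^4 \<Rightarrow> real^4^4" where
  "gram_ext v W = (\<chi> i j. mink (W $ i) (W $ j) + mink (v i) (W $ j) - mink (W $ i) (v j))"

text \<open>The antisymmetric part of \<open>gram_ext v W\<close> is exactly the correction term, so
  a symmetric value forces the correction to vanish.\<close>

lemma gram_ext_symmetric:
  assumes "gram_ext v W = G" "\<And>i j. G $ i $ j = G $ j $ i"
  shows "gram (\<lambda>i. W $ i) = G"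
proof -
  have "mink (W $ i) (W $ j) = G $ i $ j" for i j
    using assms(2)[of i j] unfolding assms(1)[symmetric]
    by (simp add: gram_ext_def mink_commute[of "v i"] mink_commute[of "v j"] mink_commute[of "W $ j" "W $ i"])
  then show ?thesis by (simp add: vec_eq_iff gram_def)
qed

lemma has_derivative_gram_ext:
  "(gram_ext v has_derivative (\<lambda>K. \<chi> i j. 2 * mink (v i) (K $ j))) (at (\<chi> i. v i))"
proof -
  have c: "((\<lambda>W. gram_ext v W $ i $ j) has_derivative (\<lambda>K. 2 * mink (v i) (K $ j))) (at (\<chi> i. v i))" for i j
  proof -
    have n: "((\<lambda>W. W $ i) has_derivative (\<lambda>K. K $ i)) (at (\<chi> i. v i))" for i
      by (rule bounded_linear_imp_has_derivative[OF bounded_linear_vec_nth])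
    have "((\<lambda>W. mink (W $ i) (W $ j) + mink (v i) (W $ j) - mink (W $ i) (v j)) has_derivative
        (\<lambda>K. (mink ((\<chi> i. v i) $ i) (K $ j) + mink (K $ i) ((\<chi> i. v i) $ j)) + mink (v i) (K $ j) - mink (K $ i) (v j)))
        (at (\<chi> i. v i))"
      by (intro has_derivative_diff has_derivative_add mink.FDERIV n
          bounded_linear.has_derivative[OF mink.bounded_linear_left]
          bounded_linear.has_derivative[OF mink.bounded_linear_right])
    then show ?thesis by (simp add: gram_ext_def)
  qed
  have "((\<lambda>W. \<chi> i j. gram_ext v W $ i $ j) has_derivative (\<lambda>K. \<chi> i j. 2 * mink (v i) (K $ j))) (at (\<chi> i. v i))"
    by (intro has_derivative_vec) (simp add: c)
  then show ?thesis by simp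
qed

lemma gram_nondegenerate:
  assumes det: "det (gram w) \<noteq> 0" and n: "\<And>i. mink n (w i) = 0"
  shows "n = 0"
proof -
  let ?A = "\<chi> i. sflip (w i)" and ?B = "\<chi> k j. w j $ k"
  have "?A ** ?B = gram w" by (simp add: vec_eq_iff matrix_sflip_mult gram_def)
  then have "det ?A * det ?B \<noteq> 0" using det by (simp flip: det_mul)
  then have "invertible ?A" by (simp add: invertible_det_nz)
  moreover have "?A *v n = 0"
    using n by (simp add: vec_eq_iff matrix_vector_mul_component inner_sflip mink_commute[of "w _" n])
  ultimately show ?thesis
    by (metis invertible_def matrix_left_invertible_ker)
qed

text \<open>Makes \<open>angles_of_lengths\<close> agree with \<open>angles_fun\<close> on a whole
  neighbourhood, which is what transfers the derivative. Points with the prescribed Gram matrix come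
  from an open mapping theorem.\<close>

lemma (in tet_frame) eventually_realizable:
  "\<forall>\<^sub>F y in nhds (lengths v).
     \<exists>w. gen_hyp_tetrahedron w \<and> (\<forall>i. vtype (w i) = vtype (v i)) \<and> lengths w = y"
proof -
  let ?\<epsilon> = "\<lambda>i. vtype (v i)" and ?V = "\<chi> i. v i"
  \<comment> \<open>The Gram matrix does not see the signs of the fourth coordinates; restricting to
    this open set keeps them positive.\<close>
  define T where "T = {W :: real^4^4. \<forall>i. W $ i $ 4 > 0}"
  have "open (\<Inter>i. {W :: real^4^4. W $ i $ 4 > 0})"
    by (intro open_INT finite ballI open_Collect_less continuous_intros)
  then have "open T" by (simp add: T_def Collect_all_eq)
  moreover have "?V \<in> T" using v_gen_points by (auto simp: T_def mem_gen_points_iff)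
  ultimately have VT: "?V \<in> interior T" by (simp add: interior_open)
  \<comment> \<open>A right inverse of the derivative of \<open>gram_ext v\<close> at
    \<open>v\<close>, by duality of \<open>v\<close> and \<open>d\<close>; the factor 1/2 cancels
    the 2 there.\<close>
  let ?g' = "\<lambda>K :: real^4^4. \<chi> j. (1/2) *\<^sub>R (\<Sum>i\<in>UNIV. K $ i $ j *\<^sub>R d i)"
  have cont: "continuous_on UNIV (gram_ext v)"
    unfolding gram_ext_def
    by (intro continuous_on_vec_lambda continuous_intros mink.continuous_on)
  have lin: "bounded_linear ?g'"
    by (intro linear_conv_bounded_linear[THEN iffD1] linearI)
      (simp_all add: vec_eq_iff algebra_simps sum.distrib sum_distrib_left)
  have inv: "(\<lambda>K. \<chi> i j. 2 * mink (v i) (K $ j)) \<circ> ?g' = id"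
    by (simp add: fun_eq_iff vec_eq_iff mink_linear mink.sum_right dual if_distrib cong: if_cong)
  have "gram_ext v ?V \<in> interior (gram_ext v ` T)"
    by (rule sussmann_open_mapping[OF open_UNIV cont UNIV_I has_derivative_gram_ext lin inv subset_UNIV VT])
  moreover have "gram_ext v ?V = gram_of_lengths ?\<epsilon> (lengths v)"
    unfolding gram_eq[symmetric] by (simp add: gram_ext_def gram_def vec_eq_iff)
  ultimately have "lengths v \<in> gram_of_lengths ?\<epsilon> -` interior (gram_ext v ` T)" by simp
  moreover have "open (gram_of_lengths ?\<epsilon> -` interior (gram_ext v ` T))"
    using continuous_gram_of_lengths by (simp add: open_vimage)
  ultimately have e1: "\<forall>\<^sub>F y in nhds (lengths v). gram_of_lengths ?\<epsilon> y \<in> interior (gram_ext v ` T)"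
    by (auto simp: eventually_nhds)
  have e2: "\<forall>\<^sub>F y in nhds (lengths v). det (gram_of_lengths ?\<epsilon> y) \<noteq> 0"
  proof (rule eventually_det_nonzero)
    show "(\<lambda>y. gram_of_lengths ?\<epsilon> y $ i $ j) differentiable at (lengths v)" for i j
      unfolding differentiable_def by (rule exI) (rule has_derivative_gram_of_lengths)
    show "det (gram_of_lengths ?\<epsilon> (lengths v)) \<noteq> 0"
      using det_gram_nonzero by (simp add: gram_eq)
  qed
  have "\<forall>\<^sub>F y in nhds (lengths v). \<forall>i. i \<noteq> j \<longrightarrow> entry y i j > 0" for j
  proof -
    have "\<forall>\<^sub>F y in nhds (lengths v). i \<noteq> j \<longrightarrow> entry y i j > 0" for i
    proof (cases "i = j")
      case False
      then have "entry (lengths v) i j > 0"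
        using edge_pair.x[OF pair[OF False]] by (simp add: entry_lengths)
      moreover have "isCont (\<lambda>y. entry y i j) (lengths v)"
        by (rule linear_continuous_at[OF bounded_linear_entry])
      then have "((\<lambda>y. entry y i j) \<longlongrightarrow> entry (lengths v) i j) (nhds (lengths v))"
        unfolding isCont_def by (rule tendsto_at_iff_tendsto_nhds[THEN iffD1])
      ultimately have "\<forall>\<^sub>F y in nhds (lengths v). entry y i j > 0"
        by (rule order_tendstoD(1)[rotated])
      then show ?thesis by eventually_elim simp
    qed simp
    then show ?thesis by (simp add: eventually_all_finite)
  qed
  then have e3: "\<forall>\<^sub>F y in nhds (lengths v). \<forall>j i. i \<noteq> j \<longrightarrow> entry y i j > 0"
    by (simp add: eventually_all_finite)
  show ?thesis using e1 e2 e3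
  proof eventually_elim
    case (elim y)
    let ?G = "gram_of_lengths ?\<epsilon> y"
    have "?G \<in> gram_ext v ` T"
      using elim(1) interior_subset[of "gram_ext v ` T"] by blast
    then obtain W where W: "W \<in> T" "gram_ext v W = ?G" by auto
    define w where "w i = W $ i" for i
    have "?G $ i $ j = ?G $ j $ i" for i j
      by (simp add: gram_of_lengths_def entry_sym[of y i j] mult.commute)
    then have G: "gram w = ?G"
      using gram_ext_symmetric[OF W(2)] by (simp add: w_def[abs_def])
    then have gij: "mink (w i) (w j) = ?G $ i $ j" for i j
      by (simp add: vec_eq_iff gram_def)
    have tw: "vtype (w i) = vtype (v i)" for i
      using gij[of i i] by (simp add: vtype_def[of "w i"]) (simp add: gram_of_lengths_def)
    have gen_points: "w i \<in> gen_points" for i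
      using W(1) v_gen_points[of i] by (simp add: mem_gen_points_iff tw) (simp add: T_def w_def)
    obtain d' where d': "\<And>i j. mink (w i) (d' j) = (if i = j then 1 else 0)"
      using dual_basis_exists[of w] gram_nondegenerate[of w] elim(2) G by metis
    have "edge_pair (w i) (w j) (entry y i j)" if "i \<noteq> j" for i j
      using gen_points elim(3) that by (simp add: edge_pair_def tw gij gram_of_lengths_def)
    then interpret w: tet_frame w d' "entry y"
      using d' by (intro tet_frame.intro)
    have "lengths w = sextuple (entry y)"
      unfolding lengths_def by (simp add: sextuple_def w.edge_length_eq)
    then show ?case
      using w.gen_hyp_tetrahedron tw by (auto simp: sextuple_entry)
  qed
qed

section \<open>The Jacobian\<close>

lemma diag_mult_diag:
  fixes M :: "real^'n^'n"
  shows "((\<chi> r s. if r = s then a r else 0) ** M ** (\<chi> r s. if r = s then b r else 0)) $ r $ s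
    = a r * M $ r $ s * b s"
  by (simp add: matrix_matrix_mult_def if_distrib if_distribR sum.delta cong: if_cong)

lemma prod_4: "prod f (UNIV :: 4 set) = f 1 * f 2 * f 3 * f 4"
  unfolding UNIV_4 by (simp add: ac_simps)

lemma UNIV_4_distinct:
  fixes i j k l :: 4
  assumes "distinct [i, j, k, l]"
  shows "UNIV = {i, j, k, l}"
proof -
  have "card {i, j, k, l} = card (UNIV :: 4 set)" using assms by simp
  then show ?thesis by (metis card_subset_eq finite subset_UNIV)
qed

context tet_frame
begin

lemma dihedral_angle_sym:
  assumes "i \<noteq> j"
  shows "dihedral_angle v i j = dihedral_angle v j i"
proof -
  obtain k l where kl: "distinct [i, j, k, l]"
  proof -
    have "card (UNIV - {i, j}) = 2" using assms by (simp add: card_Diff_subset)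
    then obtain k l where "k \<noteq> l" "UNIV - {i, j} = {k, l}" by (meson card_2_iff)
    then show ?thesis using that[of k l] assms by (simp, blast)
  qed
  then have "distinct [j, i, k, l]" by auto
  then show ?thesis using dihedral_angle_eq[OF kl] dihedral_angle_eq[of j i k l] by simp
qed

text \<open>For \<open>k \<noteq> l\<close> this is minus the cosine of the angle at the opposite
  edge (\<open>cos_dihedral\<close>); the scaling gives the unit diagonal
  \<open>h_self\<close>.\<close>

definition h :: "4 \<Rightarrow> 4 \<Rightarrow> real" where
  "h k l = H k l / sqrt (H k k * H l l)"

definition q :: "4 \<Rightarrow> real" where
  "q k = sqrt (H k k)"

definition \<Gamma> :: real where
  "\<Gamma> = sqrt (- det (gram v))"

definition \<kappa> :: real where
  "\<kappa> = \<Gamma> * (\<Prod>i\<in>UNIV. q i)"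

lemma q_pos: "q k > 0" by (simp add: q_def H_diag_pos)

lemma q_square: "q k * q k = H k k" using H_diag_pos[of k] by (simp add: q_def)

lemma h_sym: "h k l = h l k"
  by (simp add: h_def H_sym[of k l] mult.commute)

lemma h_self: "h k k = 1"
  using H_diag_pos[of k] by (simp add: h_def)

lemma H_eq: "H k l = h k l * (q k * q l)"
  using H_diag_pos[of k] H_diag_pos[of l] by (simp add: h_def q_def real_sqrt_mult)

lemma h_square_less: "k \<noteq> l \<Longrightarrow> (h k l)\<^sup>2 < 1"
  using H_minor_pos[of k l] H_diag_pos[of k] H_diag_pos[of l]
  by (simp add: h_def power_divide divide_less_eq)

lemma h_bounds: "k \<noteq> l \<Longrightarrow> -1 < h k l \<and> h k l < 1"
  using h_square_less[of k l] by (simp add: abs_square_less_1 abs_less_iff)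

lemma cos_dihedral:
  assumes "distinct [i, j, k, l]"
  shows "cos (dihedral_angle v i j) = - h k l"
  using h_bounds[of k l] assms unfolding dihedral_angle_eq[OF assms]
  by (simp add: h_def)

lemma sin_dihedral:
  assumes "distinct [i, j, k, l]"
  shows "sin (dihedral_angle v i j) = sqrt (1 - (h k l)\<^sup>2)"
  using h_bounds[of k l] assms unfolding dihedral_angle_eq[OF assms]
  by (simp add: h_def sin_arccos)

lemma sin_dihedral_pos:
  assumes "distinct [i, j, k, l]"
  shows "sin (dihedral_angle v i j) > 0"
  using h_square_less[of k l] assms by (simp add: sin_dihedral[OF assms])

text \<open>Minus the derivative of the Gram entry \<open>mink (v i) (v j)\<close> with respect to
  the edge length.\<close>

definition \<eta> :: "4 \<Rightarrow> 4 \<Rightarrow> real" where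
  "\<eta> i j = (exp (x i j) - vtype (v i) * vtype (v j) * exp (- x i j)) / 2"

lemma \<eta>_pos: "i \<noteq> j \<Longrightarrow> \<eta> i j > 0"
  using edge_pair.\<Delta>_pos[OF pair] edge_pair.\<Delta>_def[OF pair] by (simp add: \<eta>_def)

lemma gram_minor:
  assumes "i \<noteq> j"
  shows "mink (v i) (v i) * mink (v j) (v j) - mink (v i) (v j) * mink (v j) (v i) = - (\<eta> i j)\<^sup>2"
proof -
  have "exp (x i j) * exp (- x i j) = 1" by (simp flip: exp_add)
  then show ?thesis
    unfolding mink_commute[of "v j" "v i"] edge_pair.vw[OF pair[OF assms]] mink_self[of "v i"] mink_self[of "v j"] \<eta>_def
    by (simp add: field_simps power2_eq_square)
qed

lemma jacobi:
  assumes "distinct [r, s, k, l]"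
  shows "(\<eta> r s)\<^sup>2 = - det (gram v) * (H k k * H l l - (H k l)\<^sup>2)"
  using jacobi_minor_2[OF gram_H assms] gram_minor[of r s] assms
  by (simp add: gram_def H_sym[of l k] power2_eq_square)

text \<open>The sign is read off \<open>jacobi\<close>: both the square of \<open>\<eta>\<close> and
  the minor of \<open>H\<close> are positive.\<close>

lemma det_gram_neg: "det (gram v) < 0"
proof -
  have "0 < (\<eta> 1 2)\<^sup>2" using \<eta>_pos[of 1 2] by simp
  then have "0 < - det (gram v) * (H 3 3 * H 4 4 - (H 3 4)\<^sup>2)"
    by (subst jacobi[symmetric]) simp_all
  then show ?thesis using H_minor_pos[of 3 4] by (simp add: zero_less_mult_iff mult_less_0_iff)
qed

lemma \<eta>_eq:
  assumes "distinct [r, s, k, l]"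
  shows "\<eta> r s = \<Gamma> * (q k * q l) * sin (dihedral_angle v r s)"
proof -
  have kl: "k \<noteq> l" and rs: "r \<noteq> s" using assms by auto
  have "(\<eta> r s)\<^sup>2 = - det (gram v) * ((H k k * H l l) * (1 - (h k l)\<^sup>2))"
    unfolding jacobi[OF assms] H_eq[of k l] q_square[symmetric] by (simp add: algebra_simps power2_eq_square)
  moreover have "\<eta> r s = sqrt ((\<eta> r s)\<^sup>2)" using \<eta>_pos[OF rs] by simp
  ultimately have "\<eta> r s = sqrt (- det (gram v) * ((H k k * H l l) * (1 - (h k l)\<^sup>2)))" by (simp only:)
  then show ?thesis
    by (simp only: \<Gamma>_def q_def sin_dihedral[OF assms] real_sqrt_mult mult.assoc)
qed

text \<open>The factors \<open>q r * q s\<close> complete \<open>q k * q l\<close> to the product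
  over all indices, so the constant is the same for every edge. This is the origin of the single
  scalar in front of the Jacobian.\<close>

lemma \<eta>_eq_\<kappa>:
  assumes "distinct [r, s, k, l]"
  shows "q r * q s * \<eta> r s = \<kappa> * sin (dihedral_angle v r s)"
proof -
  have "\<kappa> = \<Gamma> * (q r * (q s * (q k * q l)))"
    unfolding \<kappa>_def UNIV_4_distinct[OF assms] using assms by simp
  then show ?thesis unfolding \<eta>_eq[OF assms] by simp
qed

text \<open>Each deleted determinant is \<open>det (gram v) * H i i\<close>, so the quotient under
  the root equals \<open>- det (gram v)\<close> times the product of the
  \<open>H i i\<close>.\<close>

lemma \<kappa>_eq:
  "\<kappa> = sqrt ((\<Prod>i\<in>UNIV. det (delete_row_col (gram v) i)) / (- (det (gram v) ^ 3)))"
proof -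
  have "(\<Prod>i\<in>UNIV. det (delete_row_col (gram v) i)) = (\<Prod>i\<in>UNIV. det (gram v) * H i i)"
    by (simp add: det_delete_row_col[OF gram_H])
  also have "\<dots> = det (gram v) ^ 4 * (\<Prod>i\<in>UNIV. H i i)"
    by (simp add: prod.distrib)
  finally have "(\<Prod>i\<in>UNIV. det (delete_row_col (gram v) i)) / (- (det (gram v) ^ 3))
      = - det (gram v) * (\<Prod>i\<in>UNIV. H i i)"
    using det_gram_neg by (simp add: field_simps power4_eq_xxxx power3_eq_cube)
  then show ?thesis
    by (simp only: \<kappa>_def \<Gamma>_def q_def real_sqrt_mult prod_4)
qed

text \<open>The derivative of \<open>H k l\<close> in direction \<open>y\<close>, up to the factor
  \<open>\<kappa> * (q k * q l)\<close>. No sign appears, since those of \<open>- H dG H\<close> and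
  \<open>dG = - \<eta> dx\<close> cancel.\<close>

definition T :: "real^6 \<Rightarrow> 4 \<Rightarrow> 4 \<Rightarrow> real" where
  "T y k l = (\<Sum>r\<in>UNIV. \<Sum>s\<in>UNIV. h k r * h l s * sin (dihedral_angle v r s) * entry y r s)"

lemma H_derivative:
  "((\<lambda>z. matrix_inv (gram_of_lengths (\<lambda>i. vtype (v i)) z) $ k $ l) has_derivative
     (\<lambda>y. \<kappa> * (q k * q l) * T y k l)) (at (lengths v))"
proof -
  let ?\<epsilon> = "\<lambda>i. vtype (v i)"
  let ?B = "matrix_inv (gram_of_lengths ?\<epsilon> (lengths v))"
  have B: "?B $ i $ j = H i j" for i j
    using matrix_inv_gram by (simp add: gram_eq)
  have det: "det (gram_of_lengths ?\<epsilon> (lengths v)) \<noteq> 0"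
    using det_gram_nonzero by (simp add: gram_eq)
  have summand: "H k r * (- ((exp (entry (lengths v) r s) - ?\<epsilon> r * ?\<epsilon> s * exp (- entry (lengths v) r s)) / 2) * entry y r s) * H s l
      = - (\<kappa> * (q k * q l) * (h k r * h l s * sin (dihedral_angle v r s) * entry y r s))" for r s y
  proof (cases "r = s")
    case False
    obtain a b where ab: "distinct [r, s, a, b]"
    proof -
      have "card (UNIV - {r, s}) = 2" using False by (simp add: card_Diff_subset)
      then obtain a b where "a \<noteq> b" "UNIV - {r, s} = {a, b}" by (meson card_2_iff)
      then show ?thesis using that[of a b] False by (simp, blast)
    qed
    have "(exp (entry (lengths v) r s) - ?\<epsilon> r * ?\<epsilon> s * exp (- entry (lengths v) r s)) / 2 = \<eta> r s"
      using False by (simp add: \<eta>_def entry_lengths)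
    then have "H k r * (- ((exp (entry (lengths v) r s) - ?\<epsilon> r * ?\<epsilon> s * exp (- entry (lengths v) r s)) / 2) * entry y r s) * H s l
        = - ((q k * q l) * h k r * h l s * (q r * q s * \<eta> r s) * entry y r s)"
      by (simp add: H_eq h_sym[of s l])
    also have "\<dots> = - (\<kappa> * (q k * q l) * (h k r * h l s * sin (dihedral_angle v r s) * entry y r s))"
      unfolding \<eta>_eq_\<kappa>[OF ab] by simp
    finally show ?thesis .
  qed simp
  show ?thesis
    using has_derivative_matrix_inv[OF has_derivative_gram_of_lengths det, of k l]
    unfolding B summand
    by (simp add: T_def sum_negf sum_distrib_left)
qed

text \<open>Normalizing \<open>H k l\<close> cancels the factors \<open>q\<close> and produces the
  terms \<open>T y k k\<close> and \<open>T y l l\<close>; the derivative of \<open>arccos\<close>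
  at \<open>- h k l\<close> is minus the inverse of the sine.\<close>

lemma opposite_angle_derivative:
  assumes dist: "distinct [i, j, k, l]"
  shows "((\<lambda>z. opposite_angle (matrix_inv (gram_of_lengths (\<lambda>i. vtype (v i)) z)) k l) has_derivative
    (\<lambda>y. \<kappa> * (T y k l - h k l * (T y k k + T y l l) / 2) / sin (dihedral_angle v i j))) (at (lengths v))"
proof -
  let ?B = "\<lambda>z. matrix_inv (gram_of_lengths (\<lambda>i. vtype (v i)) z)"
  have kl: "k \<noteq> l" using dist by auto
  have B: "?B (lengths v) $ i $ j = H i j" for i j
    using matrix_inv_gram by (simp add: gram_eq)
  define S where "S = sqrt (H k k * H l l)"
  have S: "S = q k * q l" by (simp add: S_def q_def real_sqrt_mult)
  have S0: "S > 0" using q_pos by (simp add: S)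
  have "((\<lambda>z. ?B z $ k $ k * ?B z $ l $ l) has_derivative
      (\<lambda>y. H k k * (\<kappa> * (q l * q l) * T y l l) + \<kappa> * (q k * q k) * T y k k * H l l)) (at (lengths v))"
    using has_derivative_mult[OF H_derivative[of k k] H_derivative[of l l]] by (simp add: B)
  then have "((\<lambda>z. sqrt (?B z $ k $ k * ?B z $ l $ l)) has_derivative
      (\<lambda>y. (H k k * (\<kappa> * (q l * q l) * T y l l) + \<kappa> * (q k * q k) * T y k k * H l l) * (inverse S / 2))) (at (lengths v))"
    by (rule has_derivative_real_sqrt[THEN has_derivative_eq_rhs, rotated]) 
       (use H_diag_pos[of k] H_diag_pos[of l] in \<open>simp_all add: B S_def field_simps fun_eq_iff\<close>)
  also have "(\<lambda>y. (H k k * (\<kappa> * (q l * q l) * T y l l) + \<kappa> * (q k * q k) * T y k k * H l l) * (inverse S / 2))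
      = (\<lambda>y. \<kappa> * S * (T y k k + T y l l) / 2)"
    using S0 q_pos[of k] q_pos[of l] by (simp add: fun_eq_iff q_square[symmetric] S field_simps)
  finally have sq: "((\<lambda>z. sqrt (?B z $ k $ k * ?B z $ l $ l)) has_derivative
      (\<lambda>y. \<kappa> * S * (T y k k + T y l l) / 2)) (at (lengths v))" .
  have "((\<lambda>z. - ?B z $ k $ l / sqrt (?B z $ k $ k * ?B z $ l $ l)) has_derivative
      (\<lambda>y. (- (\<kappa> * S * T y k l) * S - - H k l * (\<kappa> * S * (T y k k + T y l l) / 2)) / (S * S))) (at (lengths v))"
    using has_derivative_divide'[OF has_derivative_minus[OF H_derivative[of k l]] sq] S0
    by (simp add: B S_def[symmetric] S[symmetric])
  also have "(\<lambda>y. (- (\<kappa> * S * T y k l) * S - - H k l * (\<kappa> * S * (T y k k + T y l l) / 2)) / (S * S))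
      = (\<lambda>y. - \<kappa> * (T y k l - h k l * (T y k k + T y l l) / 2))"
    using S0 unfolding H_eq[of k l] S[symmetric] by (simp add: fun_eq_iff field_simps)
  finally have c: "((\<lambda>z. - ?B z $ k $ l / sqrt (?B z $ k $ k * ?B z $ l $ l)) has_derivative
      (\<lambda>y. - \<kappa> * (T y k l - h k l * (T y k k + T y l l) / 2))) (at (lengths v))" .
  have val: "- ?B (lengths v) $ k $ l / sqrt (?B (lengths v) $ k $ k * ?B (lengths v) $ l $ l) = - h k l"
    by (simp add: B h_def)
  have "(arccos has_field_derivative inverse (- sqrt (1 - (- h k l)\<^sup>2))) (at (- h k l))"
    using h_bounds[OF kl] by (intro DERIV_arccos) auto
  then have "(arccos has_field_derivative - (1 / sin (dihedral_angle v i j)))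
      (at (- ?B (lengths v) $ k $ l / sqrt (?B (lengths v) $ k $ k * ?B (lengths v) $ l $ l)))"
    unfolding val sin_dihedral[OF dist] by (simp add: field_simps)
  note d = has_derivative_compose[OF c this[unfolded has_field_derivative_def]]
  show ?thesis
    unfolding opposite_angle_def
    by (rule has_derivative_eq_rhs[OF d]) (simp add: fun_eq_iff)
qed

lemma T_expand:
  fixes y :: "real^6"
  assumes dist: "distinct [i, j, k, l]"
  defines "f \<equiv> \<lambda>r s. sin (dihedral_angle v r s) * entry y r s"
  shows "T y a b =
      (h a i * h b j + h a j * h b i) * f i j + (h a i * h b k + h a k * h b i) * f i k
    + (h a i * h b l + h a l * h b i) * f i l + (h a j * h b k + h a k * h b j) * f j k
    + (h a j * h b l + h a l * h b j) * f j l + (h a k * h b l + h a l * h b k) * f k l"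
proof -
  have sym: "f s r = f r s" for r s
    by (cases "r = s") (simp_all add: f_def entry_sym[of y s r] dihedral_angle_sym[of s r])
  have self: "f r r = 0" for r by (simp add: f_def)
  have "T y a b = (\<Sum>r\<in>{i, j, k, l}. \<Sum>s\<in>{i, j, k, l}. h a r * h b s * f r s)"
    unfolding T_def UNIV_4_distinct[OF dist] by (simp add: f_def mult.assoc)
  also have "\<dots> = (\<Sum>r\<leftarrow>[i, j, k, l]. \<Sum>s\<leftarrow>[i, j, k, l]. h a r * h b s * f r s)"
    using dist by simp
  also have "\<dots> =
      (h a i * h b j + h a j * h b i) * f i j + (h a i * h b k + h a k * h b i) * f i k
    + (h a i * h b l + h a l * h b i) * f i l + (h a j * h b k + h a k * h b j) * f j k
    + (h a j * h b l + h a l * h b j) * f j l + (h a k * h b l + h a l * h b k) * f k l"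
    by (simp add: self sym[of j i] sym[of k i] sym[of l i] sym[of k j] sym[of l j] sym[of l k] algebra_simps)
  finally show ?thesis .
qed

lemma angle_row:
  assumes dist: "distinct [i, j, k, l]"
  defines "a \<equiv> dihedral_angle v"
  defines "f \<equiv> \<lambda>y r s. sin (a r s) * entry y r s"
  shows "((\<lambda>z. opposite_angle (matrix_inv (gram_of_lengths (\<lambda>i. vtype (v i)) z)) k l) has_derivative
    (\<lambda>y. \<kappa> * sin (a i j) * (w_coeff a i j k l * f y i j - cos (a j k) * f y i k - cos (a j l) * f y i l
       - cos (a i k) * f y j k - cos (a i l) * f y j l + f y k l))) (at (lengths v))"
proof -
  have s: "sin (a i j) > 0" unfolding a_def by (rule sin_dihedral_pos[OF dist])
  have s2: "sin (a i j) * sin (a i j) = 1 - (h k l)\<^sup>2"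
    using s unfolding a_def sin_dihedral[OF dist] by simp
  have c: "cos (a i j) = - h k l" "cos (a i k) = - h j l" "cos (a i l) = - h j k"
    "cos (a j k) = - h i l" "cos (a j l) = - h i k" "cos (a k i) = - h j l" "cos (a l i) = - h j k"
    unfolding a_def using dist by (auto intro!: cos_dihedral)
  have w: "w_coeff a i j k l * (sin (a i j) * sin (a i j)) =
      h i k * h j l + h i l * h j k - h k l * (h i l * h j l + h i k * h j k)"
    using s by (simp add: w_coeff_def c power2_eq_square field_simps)
  have "\<kappa> * (T y k l - h k l * (T y k k + T y l l) / 2) / sin (a i j)
    = \<kappa> * sin (a i j) * (w_coeff a i j k l * f y i j - cos (a j k) * f y i k - cos (a j l) * f y i l
       - cos (a i k) * f y j k - cos (a i l) * f y j l + f y k l)" for y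
  proof -
    let ?R = "w_coeff a i j k l * f y i j - cos (a j k) * f y i k - cos (a j l) * f y i l
       - cos (a i k) * f y j k - cos (a i l) * f y j l + f y k l"
    \<comment> \<open>The terms of \<open>T y k k\<close> and \<open>T y l l\<close> leave the
      factor \<open>1 - (h k l)\<^sup>2\<close>, the squared sine at \<open>ij\<close>, at all edges
      but \<open>ij\<close>; at \<open>ij\<close> the denominator of \<open>w_coeff\<close> supplies
      it. Dividing by the sine then leaves one, the row factor of \<open>D_mat\<close>.\<close>
    have "T y k l - h k l * (T y k k + T y l l) / 2 =
       (h i k * h j l + h i l * h j k - h k l * (h i l * h j l + h i k * h j k)) * f y i j
      + (1 - (h k l)\<^sup>2) * (h i l * f y i k + h i k * f y i l + h j l * f y j k + h j k * f y j l + f y k l)"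
      unfolding T_expand[OF dist] h_self h_sym[of k i] h_sym[of l i] h_sym[of k j] h_sym[of l j] h_sym[of l k]
      by (simp add: f_def a_def field_simps power2_eq_square)
    also have "\<dots> = sin (a i j) * sin (a i j) * ?R"
      unfolding w[symmetric] s2[symmetric] c by (simp add: algebra_simps)
    finally show ?thesis using s by simp
  qed
  then show ?thesis
    using opposite_angle_derivative[OF dist] by (simp add: a_def)
qed

lemma jacobian_mat_nth:
  "(jacobian_mat v *v y) $ r =
     \<kappa> * sextuple (\<lambda>i j. sin (dihedral_angle v i j)) $ r *
       (\<Sum>s\<in>UNIV. M_mat (dihedral_angle v) $ r $ s * (sextuple (\<lambda>i j. sin (dihedral_angle v i j)) $ s * y $ s))"
  unfolding jacobian_mat_def Let_def \<kappa>_eq[symmetric] D_mat_def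
  by (simp add: matrix_vector_mult_def diag_mult_diag sum_distrib_left mult.assoc)

lemma has_derivative_angles_fun:
  "(angles_fun (\<lambda>i. vtype (v i)) has_derivative (\<lambda>y. jacobian_mat v *v y)) (at (lengths v))"
proof (rule has_derivative_vec)
  fix r :: 6
  let ?a = "dihedral_angle v"
  have sym: "?a 2 1 = ?a 1 2" "?a 3 1 = ?a 1 3" "?a 4 1 = ?a 1 4" "?a 3 2 = ?a 2 3" "?a 4 2 = ?a 2 4" "?a 4 3 = ?a 3 4"
    by (simp_all add: dihedral_angle_sym)
  have e: "entry y 1 2 = y $ 1" "entry y 2 1 = y $ 1" "entry y 1 3 = y $ 2" "entry y 3 1 = y $ 2"
    "entry y 1 4 = y $ 3" "entry y 4 1 = y $ 3" "entry y 2 3 = y $ 4" "entry y 3 2 = y $ 4"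
    "entry y 2 4 = y $ 5" "entry y 4 2 = y $ 5" "entry y 3 4 = y $ 6" "entry y 4 3 = y $ 6" for y
    by (simp_all add: entry_def pair_index_def)
  note nth = jacobian_mat_nth sum_6 M_mat_def vector_6 sextuple_nth
  note row = has_derivative_eq_rhs[OF angle_row]
  consider "r = 1" | "r = 2" | "r = 3" | "r = 4" | "r = 5" | "r = 6" using exhaust_6 by blast
  then show "((\<lambda>z. angles_fun (\<lambda>i. vtype (v i)) z $ r) has_derivative (\<lambda>y. (jacobian_mat v *v y) $ r)) (at (lengths v))"
  proof cases
    case 1
    show ?thesis
      unfolding 1 angles_fun_def Let_def vector_6
      by (rule row[of 1 2]) (simp_all add: fun_eq_iff nth e sym algebra_simps)
  next
    case 2
    show ?thesis
      unfolding 2 angles_fun_def Let_def vector_6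
      by (rule row[of 1 3]) (simp_all add: fun_eq_iff nth e sym algebra_simps)
  next
    case 3
    show ?thesis
      unfolding 3 angles_fun_def Let_def vector_6
      by (rule row[of 1 4]) (simp_all add: fun_eq_iff nth e sym algebra_simps)
  next
    case 4
    show ?thesis
      unfolding 4 angles_fun_def Let_def vector_6
      by (rule row[of 2 3]) (simp_all add: fun_eq_iff nth e sym algebra_simps)
  next
    case 5
    show ?thesis
      unfolding 5 angles_fun_def Let_def vector_6
      by (rule row[of 2 4]) (simp_all add: fun_eq_iff nth e sym algebra_simps)
  next
    case 6
    show ?thesis
      unfolding 6 angles_fun_def Let_def vector_6
      by (rule row[of 3 4]) (simp_all add: fun_eq_iff nth e sym algebra_simps)
  qed
qed

end

theorem theorem1:
  fixes v :: "4 \<Rightarrow> real^4"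
  assumes "gen_hyp_tetrahedron v"
  shows "angles_of_lengths (\<lambda>i. vtype (v i)) (lengths v) = angles v \<and>
         (angles_of_lengths (\<lambda>i. vtype (v i)) has_derivative (\<lambda>h. jacobian_mat v *v h))
           (at (lengths v))"
proof -
  obtain d where "tet_frame v d (edge_length v)"
    using gen_hyp_tetrahedron_frame[OF assms] .
  then interpret tet_frame v d "edge_length v" .
  have "\<forall>\<^sub>F y in nhds (lengths v).
      angles_fun (\<lambda>i. vtype (v i)) y = angles_of_lengths (\<lambda>i. vtype (v i)) y"
    using eventually_realizable by eventually_elim (use angles_of_lengths_eq in force)
  then have "(angles_of_lengths (\<lambda>i. vtype (v i)) has_derivative (\<lambda>h. jacobian_mat v *v h))
      (at (lengths v))"
    by (rule has_derivative_transform_nhds[OF has_derivative_angles_fun])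
  moreover have "angles_of_lengths (\<lambda>i. vtype (v i)) (lengths v) = angles v"
    unfolding angles_eq using assms by (intro angles_of_lengths_eq) auto
  ultimately show ?thesis by blast
qed

end
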